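(* Let $G$ be a finite, connected metric tree and let $\lambda_1(G) \leq \lambda_2(G) \leq \dots$ be the eigenvalues of the standard Laplacian $-\Delta_G$, counted with multiplicities. Then $$\lambda_{k+1}(G) \leq \frac{k^2 \pi^2}{\operatorname{diam}(G)^2}$$ holds for all $k \in \mathbb{N} = \{1,2,\dots\}$.
   Context: A finite metric graph $G$ consists of a finite vertex set $V$, a finite edge set $E$ (with at least one edge) and a length function $L : E \to (0,\infty)$; each edge $e$ is identified with the interval $[0, L(e)]$, running from its originating vertex $o(e)$ (coordinate $0$) to its terminal vertex $t(e)$ (coordinate $L(e)$). This induces a (path) metric $\operatorname{dist}$ on $G$, and $\operatorname{diam}(G) = \sup\{\operatorname{dist}(x,y) : x, y \in G\}$, where $x,y$ range over all points of $G$ (not only vertices). $G$ is a tree if it is connected and contains no cycles (equivalently, it is connected and $|V| = |E|+1$). $L^2(G)$ is the space of square-integrable functions $f : G \to \mathbb{C}$, and $f_e$ denotes the restriction of $f$ to $e$, viewed as a function on $[0,L(e)]$. Let $\widetilde H^k(G) = \bigoplus_{e \in E} H^k(e)$ and let $H^1(G)$ be the set of $f \in \widetilde H^1(G)$ that are continuous on $G$ (the limit values at each vertex $v$ coincide along all edges incident to $v$). For $f \in H^1(G) \cap \widetilde H^2(G)$ and $v \in V$ put $\partial_\nu f(v) = \sum_{t(e)=v} f_e'(L(e)) - \sum_{o(e)=v} f_e'(0)$. The standard Laplacian $-\Delta_G$ in $L^2(G)$ acts by $(-\Delta_G f)_e = -f_e''$ on the domain of all $f \in H^1(G) \cap \widetilde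 H^2(G)$ with $\partial_\nu f(v) = 0$ for all $v \in V$. It is selfadjoint with purely discrete, nonnegative spectrum; its eigenvalues, counted with multiplicities and listed in nondecreasing order, are $0 = \lambda_1(G) \leq \lambda_2(G) \leq \dots$, and they satisfy $$\lambda_k(G) = \min_{F \subset H^1(G),\ \dim F = k}\ \max_{f \in F,\ f \neq 0} \frac{\int_G |f'|^2\,dx}{\int_G |f|^2\,dx}, \quad k = 1, 2, \dots.$$ *)

theory Defs
  imports
    "HOL-Analysis.Analysis"
    "HOL-Library.Function_Algebras"
    "Graph_Theory.Digraph_Component"
begin

section \<open>Finite metric graphs\<close>

text \<open>
  The combinatorial graph is a finite multi-digraph (loops and parallel edges allowed); an edge \<open>e\<close>
  originates at \<open>tail G e\<close> and terminates at \<open>head G e\<close>. The orientation only fixes coordinates,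
  so all path notions below ignore it.
\<close>

locale metric_graph = fin_digraph G for G :: "('v, 'e) pre_digraph" +
  fixes L :: "'e \<Rightarrow> real"
  assumes has_edge: "arcs G \<noteq> {}"
    and length_pos: "\<And>e. e \<in> arcs G \<Longrightarrow> 0 < L e"

text \<open>
  Every edge doubled by its reversal: \<open>(e, True)\<close> runs along \<open>e\<close>, \<open>(e, False)\<close> against it.
  Undirected walks in \<open>G\<close> are the directed walks in \<open>bidirected G\<close>. The library's \<open>mk_symmetric\<close>
  would merge parallel edges.
\<close>

definition bidirected :: "('v, 'e) pre_digraph \<Rightarrow> ('v, 'e \<times> bool) pre_digraph" where
  "bidirected G =
    \<lparr> verts = verts G, arcs = arcs G \<times> UNIV,
      tail = (\<lambda>(e, b). if b then tail G e else head G e),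
      head = (\<lambda>(e, b). if b then head G e else tail G e) \<rparr>"

text \<open>
  The library's \<open>tree\<close> excludes only directed cycles. Here a cycle may traverse edges in either
  direction, but no edge twice; loops and pairs of parallel edges are cycles.
\<close>

definition graph_cycle :: "('v, 'e) pre_digraph \<Rightarrow> ('e \<times> bool) list \<Rightarrow> bool" where
  "graph_cycle G p \<longleftrightarrow> pre_digraph.cycle (bidirected G) p \<and> distinct (map fst p)"

definition graph_tree :: "('v, 'e) pre_digraph \<Rightarrow> bool" where
  "graph_tree G \<longleftrightarrow> Digraph_Component.connected G \<and> (\<nexists>p. graph_cycle G p)"

text \<open>
  A point of the metric graph is given by an edge and a coordinate on it. A vertex is represented by
  several such pairs, at mutual distance 0; in a connected graph with at least one edge, every vertex
  is represented.
\<close>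

definition mg_points :: "('v, 'e) pre_digraph \<Rightarrow> ('e \<Rightarrow> real) \<Rightarrow> ('e \<times> real) set" where
  "mg_points G L = (SIGMA e : arcs G. {0..L e})"

text \<open>The two ways to leave an edge from a point on it: end vertex reached and distance to it.\<close>

definition mg_exits :: "('v, 'e) pre_digraph \<Rightarrow> ('e \<Rightarrow> real) \<Rightarrow> 'e \<times> real \<Rightarrow> ('v \<times> real) set" where
  "mg_exits G L = (\<lambda>(e, x). {(tail G e, x), (head G e, L e - x)})"

text \<open>
  Lengths of the paths joining two points: the segment inside a common edge, or a path that leaves the
  first edge through an end vertex, follows an edge walk, and enters the second edge through an end
  vertex.
\<close>

definition mg_path_lengths ::
    "('v, 'e) pre_digraph \<Rightarrow> ('e \<Rightarrow> real) \<Rightarrow> 'e \<times> real \<Rightarrow> 'e \<times> real \<Rightarrow> real set" where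
  "mg_path_lengths G L P Q =
     (if fst P = fst Q then {\<bar>snd P - snd Q\<bar>} else {}) \<union>
     {r + (\<Sum>a\<leftarrow>p. L (fst a)) + s | u r p v s.
        (u, r) \<in> mg_exits G L P \<and> (v, s) \<in> mg_exits G L Q \<and>
        pre_digraph.awalk (bidirected G) u p v}"

definition mg_dist :: "('v, 'e) pre_digraph \<Rightarrow> ('e \<Rightarrow> real) \<Rightarrow> 'e \<times> real \<Rightarrow> 'e \<times> real \<Rightarrow> real" where
  "mg_dist G L P Q = Inf (mg_path_lengths G L P Q)"

definition mg_diam :: "('v, 'e) pre_digraph \<Rightarrow> ('e \<Rightarrow> real) \<Rightarrow> real" where
  "mg_diam G L = Sup {mg_dist G L P Q | P Q. P \<in> mg_points G L \<and> Q \<in> mg_points G L}"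


section \<open>Sobolev spaces on an interval\<close>

definition square_integrable :: "real \<Rightarrow> (real \<Rightarrow> complex) \<Rightarrow> bool" where
  "square_integrable l f \<longleftrightarrow>
     f \<in> borel_measurable (lebesgue_on {0..l}) \<and>
     integrable (lebesgue_on {0..l}) (\<lambda>x. (cmod (f x))\<^sup>2)"

text \<open>
  \<open>f\<close> is (the absolutely continuous representative of a function) in \<open>H\<^sup>1(0,l)\<close>, with weak
  derivative \<open>g\<close>. The relation is insensitive to changes of \<open>g\<close> on null sets.
\<close>

definition has_weak_derivative :: "real \<Rightarrow> (real \<Rightarrow> complex) \<Rightarrow> (real \<Rightarrow> complex) \<Rightarrow> bool" where
  "has_weak_derivative l f g \<longleftrightarrow>
     square_integrable l g \<and>
     (\<forall>x\<in>{0..l}. f x = f 0 + integral\<^sup>L (lebesgue_on {0..x}) g)"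

text \<open>
  For \<open>k \<ge> 1\<close> this describes the representatives of elements of \<open>H\<^sup>k(0,l)\<close> that are \<open>k - 1\<close> times
  continuously differentiable on \<open>{0..l}\<close>, so boundary values of \<open>f\<close> and, for \<open>k \<ge> 2\<close>, of \<open>f'\<close>
  are honest point values.
\<close>

primrec sobolev :: "nat \<Rightarrow> real \<Rightarrow> (real \<Rightarrow> complex) \<Rightarrow> bool" where
  "sobolev 0 l f \<longleftrightarrow> square_integrable l f"
| "sobolev (Suc k) l f \<longleftrightarrow> (\<exists>g. has_weak_derivative l f g \<and> sobolev k l g)"


section \<open>Function spaces on a metric graph\<close>

text \<open>
  A function on the graph is the family of its restrictions \<open>f e\<close> to the edges, made unique by the
  value 0 outside the edges. The complex vector space structure is the pointwise one.
\<close>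

type_synonym 'e graph_fun = "'e \<Rightarrow> real \<Rightarrow> complex"

definition gf_scale :: "complex \<Rightarrow> 'e graph_fun \<Rightarrow> 'e graph_fun" where
  "gf_scale c f = (\<lambda>e x. c * f e x)"

interpretation graph_fun: vector_space gf_scale
  by unfold_locales (auto simp: gf_scale_def fun_eq_iff algebra_simps)

definition graph_funs :: "('v, 'e) pre_digraph \<Rightarrow> ('e \<Rightarrow> real) \<Rightarrow> 'e graph_fun set" where
  "graph_funs G L = {f. \<forall>e x. e \<notin> arcs G \<or> x \<notin> {0..L e} \<longrightarrow> f e x = 0}"

definition H_edgewise :: "nat \<Rightarrow> ('v, 'e) pre_digraph \<Rightarrow> ('e \<Rightarrow> real) \<Rightarrow> 'e graph_fun set" where
  "H_edgewise k G L = {f \<in> graph_funs G L. \<forall>e\<in>arcs G. sobolev k (L e) (f e)}"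

definition continuous_at_vertices ::
    "('v, 'e) pre_digraph \<Rightarrow> ('e \<Rightarrow> real) \<Rightarrow> 'e graph_fun \<Rightarrow> bool" where
  "continuous_at_vertices G L f \<longleftrightarrow>
     (\<forall>v\<in>verts G. \<exists>c. \<forall>e\<in>arcs G.
        (tail G e = v \<longrightarrow> f e 0 = c) \<and> (head G e = v \<longrightarrow> f e (L e) = c))"

definition H1 :: "('v, 'e) pre_digraph \<Rightarrow> ('e \<Rightarrow> real) \<Rightarrow> 'e graph_fun set" where
  "H1 G L = {f \<in> H_edgewise 1 G L. continuous_at_vertices G L f}"


section \<open>The standard Laplacian and its eigenvalues\<close>

definition edge_deriv :: "('e \<Rightarrow> real) \<Rightarrow> 'e graph_fun \<Rightarrow> 'e \<Rightarrow> real \<Rightarrow> complex" where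
  "edge_deriv L f e x = vector_derivative (f e) (at x within {0..L e})"

definition normal_deriv ::
    "('v, 'e) pre_digraph \<Rightarrow> ('e \<Rightarrow> real) \<Rightarrow> 'e graph_fun \<Rightarrow> 'v \<Rightarrow> complex" where
  "normal_deriv G L f v =
     (\<Sum>e\<in>{e \<in> arcs G. head G e = v}. edge_deriv L f e (L e)) -
     (\<Sum>e\<in>{e \<in> arcs G. tail G e = v}. edge_deriv L f e 0)"

definition laplacian_domain :: "('v, 'e) pre_digraph \<Rightarrow> ('e \<Rightarrow> real) \<Rightarrow> 'e graph_fun set" where
  "laplacian_domain G L =
     {f \<in> H1 G L \<inter> H_edgewise 2 G L. \<forall>v\<in>verts G. normal_deriv G L f v = 0}"

text \<open>
  The graph of the operator: \<open>f\<close> lies in the domain and \<open>h\<close> is a representative of the element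
  \<open>(- f\<^sub>e'')\<^sub>e\<close> of \<open>L\<^sup>2\<close>.
\<close>

definition standard_laplacian ::
    "('v, 'e) pre_digraph \<Rightarrow> ('e \<Rightarrow> real) \<Rightarrow> 'e graph_fun \<Rightarrow> 'e graph_fun \<Rightarrow> bool" where
  "standard_laplacian G L f h \<longleftrightarrow>
     f \<in> laplacian_domain G L \<and> h \<in> graph_funs G L \<and>
     (\<forall>e\<in>arcs G. \<exists>g. has_weak_derivative (L e) (f e) g \<and>
                     has_weak_derivative (L e) g (\<lambda>x. - h e x))"

text \<open>Only real \<open>\<nu>\<close> are considered since the operator is selfadjoint.\<close>

definition eigenspace :: "('v, 'e) pre_digraph \<Rightarrow> ('e \<Rightarrow> real) \<Rightarrow> real \<Rightarrow> 'e graph_fun set" where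
  "eigenspace G L \<nu> = {f. standard_laplacian G L f (gf_scale (complex_of_real \<nu>) f)}"

definition multiplicity :: "('v, 'e) pre_digraph \<Rightarrow> ('e \<Rightarrow> real) \<Rightarrow> real \<Rightarrow> nat" where
  "multiplicity G L \<nu> = graph_fun.dim (eigenspace G L \<nu>)"

text \<open>
  The \<open>k\<close>-th eigenvalue (\<open>k \<ge> 1\<close>) in nondecreasing order: the least \<open>\<mu>\<close> such that at least \<open>k\<close>
  eigenvalues, counted with multiplicities, are at most \<open>\<mu>\<close>. Members of \<open>S\<close> that are not
  eigenvalues contribute 0.
\<close>

definition eigval :: "('v, 'e) pre_digraph \<Rightarrow> ('e \<Rightarrow> real) \<Rightarrow> nat \<Rightarrow> real" where
  "eigval G L k =
     Inf {\<mu>. \<exists>S. finite S \<and> S \<subseteq> {..\<mu>} \<and> k \<le> (\<Sum>\<nu>\<in>S. multiplicity G L \<nu>)}"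

text \<open>Any nondecreasing list of the eigenvalues, counted with multiplicities, is given by \<open>eigval\<close>.\<close>

lemma eigval_eq_enumeration:
  fixes lam :: "nat \<Rightarrow> real"
  assumes mono: "\<And>i j. 1 \<le> i \<Longrightarrow> i \<le> j \<Longrightarrow> lam i \<le> lam j"
    and fin: "\<And>\<nu>. finite {j. 1 \<le> j \<and> lam j = \<nu>}"
    and mult: "\<And>\<nu>. card {j. 1 \<le> j \<and> lam j = \<nu>} = multiplicity G L \<nu>"
    and k: "1 \<le> k"
  shows "eigval G L k = lam k"
proof -
  have sum_eq: "(\<Sum>\<nu>\<in>S. multiplicity G L \<nu>) = card {j. 1 \<le> j \<and> lam j \<in> S}"
    and fin_S: "finite {j. 1 \<le> j \<and> lam j \<in> S}" if "finite S" for S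
  proof -
    have U: "{j. 1 \<le> j \<and> lam j \<in> S} = (\<Union>\<nu>\<in>S. {j. 1 \<le> j \<and> lam j = \<nu>})" by auto
    show "finite {j. 1 \<le> j \<and> lam j \<in> S}" unfolding U using that fin by blast
    show "(\<Sum>\<nu>\<in>S. multiplicity G L \<nu>) = card {j. 1 \<le> j \<and> lam j \<in> S}"
      unfolding U mult[symmetric] by (subst card_UN_disjoint) (use that fin in auto)
  qed
  have "{\<mu>. \<exists>S. finite S \<and> S \<subseteq> {..\<mu>} \<and> k \<le> (\<Sum>\<nu>\<in>S. multiplicity G L \<nu>)} = {lam k..}"
  proof (intro equalityI subsetI)
    fix \<mu> assume "\<mu> \<in> {\<mu>. \<exists>S. finite S \<and> S \<subseteq> {..\<mu>} \<and> k \<le> (\<Sum>\<nu>\<in>S. multiplicity G L \<nu>)}"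
    then obtain S where S: "finite S" "S \<subseteq> {..\<mu>}" "k \<le> card {j. 1 \<le> j \<and> lam j \<in> S}"
      using sum_eq by auto
    show "\<mu> \<in> {lam k..}"
    proof (rule ccontr)
      assume "\<mu> \<notin> {lam k..}"
      then have "{j. 1 \<le> j \<and> lam j \<in> S} \<subseteq> {1..<k}"
        using S(2) mono[OF k] by (force simp: not_le[symmetric])
      then have "card {j. 1 \<le> j \<and> lam j \<in> S} \<le> card {1..<k}" by (intro card_mono) auto
      then show False using S(3) k by simp
    qed
  next
    fix \<mu> assume "\<mu> \<in> {lam k..}"
    moreover have "lam ` {1..k} \<subseteq> {..lam k}" using mono by auto
    moreover have "card {1..k} \<le> card {j. 1 \<le> j \<and> lam j \<in> lam ` {1..k}}"
      by (intro card_mono fin_S) auto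
    ultimately show "\<mu> \<in> {\<mu>. \<exists>S. finite S \<and> S \<subseteq> {..\<mu>} \<and> k \<le> (\<Sum>\<nu>\<in>S. multiplicity G L \<nu>)}"
      by (intro CollectI exI[of _ "lam ` {1..k}"]) (auto simp: sum_eq intro: order_trans)
  qed
  then show ?thesis by (simp add: eigval_def)
qed

end

theory Submission
  imports Defs
begin

text \<open>
  Let \<open>\<Lambda>\<close> be the length of a longest trail in the tree. Any two points are joined by a path that is
  part of a trail (\<open>distance_le_trail\<close>), so \<open>\<Lambda>\<close> is at least the diameter, and it suffices to find \<open>k + 1\<close>
  eigenvalues, counted with multiplicities, in \<open>[0, \<mu>]\<close> for \<open>\<mu> = (k \<pi> / \<Lambda>)\<^sup>2\<close>.

  Every edge of a tree is a bridge, so increments along the edges can be prescribed freely: some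
  vertex function realises them (\<open>potential_exists\<close>). Prescribing \<open>\<plusminus>L e\<close> on the edges of the trail,
  according to the direction of travel, and \<open>0\<close> on all other edges gives a coordinate \<open>x\<close> on the tree
  that runs from \<open>0\<close> to \<open>\<Lambda>\<close> along the trail and is constant on every other edge. The pullbacks of
  the \<open>k + 1\<close> pieces into which its zeros cut \<open>cos (k \<pi> x / \<Lambda>)\<close> on \<open>[0, \<Lambda>]\<close> have disjoint supports.
  On their span \<open>\<integral>|f'|\<^sup>2 - \<mu> \<integral>|f|\<^sup>2\<close> is at most \<open>0\<close>: along the trail the integrals reduce to boundary
  terms that telescope to \<open>0\<close>, and the other edges contribute only \<open>- \<mu> \<integral>|f|\<^sup>2\<close>.

  The min-max principle would now finish the proof. Only the part used here is established: a
  nonpositive subspace of dimension \<open>k + 1\<close> forces \<open>k + 1\<close> eigenvalues up to \<open>\<mu>\<close>. To this end the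
  problem is made finite-dimensional without losing eigenvalues up to \<open>\<mu>\<close>. Divide each edge into
  \<open>n\<close> equal pieces shorter than \<open>\<pi> / \<surd>\<mu>\<close>. For \<open>0 \<le> t \<le> \<mu>\<close> a function that solves \<open>- f'' = t f\<close> on every
  piece is determined by its values at the nodes, and its energy \<open>\<integral>|f'|\<^sup>2 - t \<integral>|f|\<^sup>2\<close> is a Hermitian form
  \<open>H t\<close> in these values. A vector in the radical of \<open>H t\<close> consists of the node values of an
  eigenfunction to the eigenvalue \<open>t\<close>, because orthogonality to the delta functions at the nodes says
  that the derivatives match at inner nodes and satisfy the Kirchhoff condition at vertices
  (\<open>nullity_le_multiplicity\<close>). The test functions above enter through their node values, whose energy
  can only be lower (\<open>piece_form_domain_cos_le\<close>).

  The form \<open>H 0\<close> is nonnegative, \<open>H t\<close> depends continuously on \<open>t\<close>, and \<open>H \<mu>\<close> is nonpositive on a subspace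
  of dimension \<open>k + 1\<close>. Definiteness on a fixed subspace survives small changes of \<open>t\<close>, so the number of
  negative directions can grow only where the form degenerates, and there by at most the nullity. Hence
  the nullities over \<open>[0, \<mu>]\<close> add up to at least \<open>k + 1\<close> (\<open>spectral_flow\<close>).
\<close>

section \<open>Continuous families of Hermitian forms\<close>

context vector_space
begin

text \<open>
  In a space of infinite dimension \<open>dim\<close> takes the value 0 on subspaces without a finite basis; a finite
  spanning set of some larger subspace excludes this.
\<close>

lemma independent_card_le_dim_of_finite_span:
  assumes "independent B" "B \<subseteq> V" "V \<subseteq> span T" "finite T"
  shows "finite B \<and> card B \<le> dim V"
proof -
  obtain B' where B': "B' \<subseteq> V" "independent B'" "V \<subseteq> span B'" "card B' = dim V"
    using basis_exists by blast
  have "finite B'" using independent_span_bound[OF assms(4) B'(2)] B'(1) assms(3) by blast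
  from independent_span_bound[OF this assms(1)] B' assms(2) show ?thesis by auto
qed

lemma independent_Un_of_spans_disjoint:
  assumes P: "independent P" "finite P" and M: "independent M" "finite M"
    and disj: "\<And>v. v \<in> span P \<Longrightarrow> v \<in> span M \<Longrightarrow> v = 0"
  shows "independent (P \<union> M)" and "P \<inter> M = {}"
proof -
  show PM: "P \<inter> M = {}"
  proof (rule ccontr)
    assume "P \<inter> M \<noteq> {}"
    then obtain v where "v \<in> P" "v \<in> M" by auto
    moreover from this have "v = 0" by (intro disj span_base)
    ultimately show False using P(1) dependent_zero by blast
  qed
  show "independent (P \<union> M)"
  proof (rule independent_if_scalars_zero)
    show "finite (P \<union> M)" using P M by simp
  next
    fix f v assume sum0: "(\<Sum>x\<in>P \<union> M. scale (f x) x) = 0" and v: "v \<in> P \<union> M"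
    let ?p = "\<Sum>x\<in>P. scale (f x) x" and ?m = "\<Sum>x\<in>M. scale (f x) x"
    have "?p + ?m = 0" using sum0 P M PM by (simp add: sum.union_disjoint)
    then have "?p = - ?m" by (simp add: eq_neg_iff_add_eq_0)
    moreover have "- ?m \<in> span M" by (intro span_neg span_sum span_scale span_base)
    moreover have "?p \<in> span P" by (intro span_sum span_scale span_base)
    ultimately have "?p = 0" "?m = 0" using disj by (metis, metis neg_equal_0_iff_equal)
    then show "f v = 0" using v independentD[OF P(1,2)] independentD[OF M(1,2)] by blast
  qed
qed

end

locale hermitian_form = vector_space scale
  for scale :: "complex \<Rightarrow> 'b::ab_group_add \<Rightarrow> 'b" +
  fixes H :: "'b \<Rightarrow> 'b \<Rightarrow> complex"
  assumes add_left: "H (u + v) w = H u w + H v w"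
    and scale_left: "H (scale c u) w = c * H u w"
    and hermitian: "H w u = cnj (H u w)"
begin

text \<open>
  Taken relative to a subspace \<open>V\<close>, since the node values below form a proper subspace of their type.
\<close>

definition radical :: "'b set \<Rightarrow> 'b set" where
  "radical V = {v \<in> V. \<forall>w\<in>V. H v w = 0}"

lemma add_right: "H w (u + v) = H w u + H w v"
  by (metis add_left hermitian complex_cnj_add)

lemma scale_right: "H w (scale c u) = cnj c * H w u"
  by (metis scale_left hermitian complex_cnj_mult)

lemma zero_left: "H 0 w = 0"
  using scale_left[of 0 0 w] by simp

lemma zero_right: "H w 0 = 0"
  using scale_right[of w 0 0] by simp

lemma sum_left: "H (\<Sum>b\<in>N. g b) w = (\<Sum>b\<in>N. H (g b) w)"
  by (induction N rule: infinite_finite_induct) (auto simp: zero_left add_left)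

lemma sum_right: "H w (\<Sum>b\<in>N. g b) = (\<Sum>b\<in>N. H w (g b))"
  by (induction N rule: infinite_finite_induct) (auto simp: zero_right add_right)

lemma diff_left: "H (u - v) w = H u w - H v w"
  using add_left[of "u - v" v w] by simp

lemma diag_real: "H v v = complex_of_real (Re (H v v))"
  using hermitian[of v v] by (metis complex_cnj_cancel_iff Reals_cnj_iff of_real_Re)

lemma orthogonal_independent:
  assumes "finite N" and nz: "\<And>b. b \<in> N \<Longrightarrow> H b b \<noteq> 0"
    and orth: "\<And>b b'. b \<in> N \<Longrightarrow> b' \<in> N \<Longrightarrow> b \<noteq> b' \<Longrightarrow> H b b' = 0"
  shows "independent N"
proof (rule independent_if_scalars_zero[OF assms(1)])
  fix f v assume s: "(\<Sum>x\<in>N. scale (f x) x) = 0" and v: "v \<in> N"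
  have "0 = H (\<Sum>x\<in>N. scale (f x) x) v" by (simp add: s zero_left)
  also have "\<dots> = (\<Sum>x\<in>N. f x * H x v)" by (simp add: sum_left scale_left)
  also have "\<dots> = (\<Sum>x\<in>N. if x = v then f v * H v v else 0)"
    using orth v by (intro sum.cong) auto
  also have "\<dots> = f v * H v v" using assms(1) v by simp
  finally show "f v = 0" using nz v by simp
qed

text \<open>
  A largest orthogonal system \<open>N\<close> of vectors that are not isotropic. By maximality all vectors of \<open>V\<close>
  orthogonal to \<open>N\<close> are isotropic; by polarization the form then vanishes on that orthogonal complement,
  which therefore lies in the radical. This replaces a diagonalization of the form: the signs on \<open>N\<close> give
  the signature, and the nullity is what is missing to the dimension.
\<close>

lemma orthogonal_decomposition:
  assumes V: "subspace V" "V \<subseteq> span T" "finite T"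
  obtains N where "finite N" "N \<subseteq> V" "\<And>b. b \<in> N \<Longrightarrow> H b b \<noteq> 0"
    "\<And>b b'. b \<in> N \<Longrightarrow> b' \<in> N \<Longrightarrow> b \<noteq> b' \<Longrightarrow> H b b' = 0"
    "dim V \<le> card N + dim (radical V)"
proof -
  define good where "good N \<longleftrightarrow> finite N \<and> N \<subseteq> V \<and> (\<forall>b\<in>N. H b b \<noteq> 0) \<and>
    (\<forall>b\<in>N. \<forall>b'\<in>N. b \<noteq> b' \<longrightarrow> H b b' = 0)" for N
  have bd: "card N \<le> dim V" if "good N" for N
    using that orthogonal_independent[of N] independent_card_le_dim_of_finite_span[of N V T] V
    unfolding good_def by blast
  have "good {}" by (simp add: good_def)
  then obtain N where N: "good N" and max: "\<And>M. good M \<Longrightarrow> card M \<le> card N"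
    using ex_has_greatest_nat[of good "{}" card "Suc (dim V)"] bd by (auto simp: less_Suc_eq_le)
  have fin: "finite N" using N by (simp add: good_def)
  define W where "W = {w \<in> V. \<forall>b\<in>N. H w b = 0}"
  have null: "H w w = 0" if "w \<in> W" for w
  proof (rule ccontr)
    assume nz: "H w w \<noteq> 0"
    have "w \<notin> N" using that nz by (auto simp: W_def)
    have "H b w = 0" if "b \<in> N" for b using \<open>w \<in> W\<close> that hermitian[of b w] by (simp add: W_def)
    then have "good (insert w N)" using N that nz by (auto simp: good_def W_def)
    from max[OF this] \<open>w \<notin> N\<close> fin show False by simp
  qed
  have Wsub: "u + scale t w \<in> W" if "u \<in> W" "w \<in> W" for u w t
    using that V(1) by (auto simp: W_def add_left scale_left intro!: subspace_add subspace_scale)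
  \<comment> \<open>polarization: the vector \<open>u + t w\<close> with \<open>t = H u w\<close> is isotropic, which yields \<open>|t|\<^sup>2 = 0\<close>\<close>
  have polar: "H u w = 0" if uw: "u \<in> W" "w \<in> W" for u w
  proof -
    let ?t = "H u w"
    have "0 = H (u + scale ?t w) (u + scale ?t w)" using null[OF Wsub[OF uw]] by simp
    also have "\<dots> = cnj ?t * H u w + ?t * H w u"
      by (simp add: add_left add_right scale_left scale_right null uw)
    also have "\<dots> = 2 * (?t * cnj ?t)" using hermitian[of w u] by simp
    finally show ?thesis by simp
  qed
  \<comment> \<open>orthogonal projection onto the span of \<open>N\<close>\<close>
  define pr where "pr v = (\<Sum>b\<in>N. scale (H v b / H b b) b)" for v
  have prW: "v - pr v \<in> W" if "v \<in> V" for v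
  proof -
    have "H (pr v) b = H v b" if b: "b \<in> N" for b
    proof -
      have "H (pr v) b = (\<Sum>x\<in>N. H v x / H x x * H x b)" by (simp add: pr_def sum_left scale_left)
      also have "\<dots> = (\<Sum>x\<in>N. if x = b then H v b else 0)"
        using N b by (intro sum.cong) (auto simp: good_def)
      finally show ?thesis using fin b by simp
    qed
    moreover have "pr v \<in> V" unfolding pr_def
      using N V(1) by (intro subspace_sum subspace_scale) (auto simp: good_def)
    ultimately show ?thesis using that V(1) by (auto simp: W_def diff_left intro: subspace_diff)
  qed
  have Wrad: "W \<subseteq> radical V"
  proof
    fix w assume w: "w \<in> W"
    have "H w v = 0" if v: "v \<in> V" for v
    proof -
      have "H w v = H w (pr v + (v - pr v))" by simp
      also have "\<dots> = H w (pr v) + H w (v - pr v)" by (rule add_right)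
      also have "H w (pr v) = 0"
        using w by (auto simp: pr_def sum_right scale_right W_def intro!: sum.neutral)
      finally show ?thesis using polar[OF w prW[OF v]] by simp
    qed
    then show "w \<in> radical V" using w by (auto simp: radical_def W_def)
  qed
  obtain K where K: "K \<subseteq> radical V" "independent K" "radical V \<subseteq> span K" "card K = dim (radical V)"
    using basis_exists by blast
  have "finite K" using independent_card_le_dim_of_finite_span[of K V T] K V
    by (auto simp: radical_def)
  have "V \<subseteq> span (N \<union> K)"
  proof
    fix v assume "v \<in> V"
    then have "v - pr v \<in> span (N \<union> K)"
      using prW Wrad K(3) span_mono[of K "N \<union> K"] by blast
    moreover have "pr v \<in> span (N \<union> K)"
      unfolding pr_def by (intro span_sum span_scale span_base) auto
    ultimately show "v \<in> span (N \<union> K)" using span_add by fastforce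
  qed
  then have "dim V \<le> card (N \<union> K)" using dim_le_card fin \<open>finite K\<close> by blast
  also have "\<dots> \<le> card N + dim (radical V)" using card_Un_le[of N K] K(4) by simp
  finally show ?thesis using N by (intro that[of N]) (auto simp: good_def)
qed

text \<open>
  Diagonal dominance: each off-diagonal term is absorbed by the two diagonal terms in its row and column,
  because \<open>2 |c| |c'| \<le> |c|\<^sup>2 + |c'|\<^sup>2\<close>. The sign \<open>\<sigma>\<close> treats positive and negative definiteness at once.
\<close>

lemma definite_on_span_of_dominant:
  assumes "finite N" and \<sigma>: "\<bar>\<sigma>\<bar> = 1"
    and dom: "\<And>b. b \<in> N \<Longrightarrow> (\<Sum>b'\<in>N - {b}. cmod (H b b')) < \<sigma> * Re (H b b)"
    and v: "v \<in> span N" "v \<noteq> 0"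
  shows "0 < \<sigma> * Re (H v v)"
proof -
  obtain c where c: "v = (\<Sum>b\<in>N. scale (c b) b)"
    using v(1) span_finite[OF assms(1)] by auto
  have "\<exists>b\<in>N. c b \<noteq> 0"
    using v(2) by (auto simp: c intro: sum.neutral)
  then obtain b0 where b0: "b0 \<in> N" "c b0 \<noteq> 0" by auto
  define K where "K b = (\<Sum>b'\<in>N - {b}. cmod (H b b'))" for b
  define off where "off b b' = (if b = b' then 0 else cmod (H b b'))" for b b'
  have off_sym: "off b b' = off b' b" for b b'
    using hermitian[of b b'] by (simp add: off_def)
  have K_off: "K b = (\<Sum>b'\<in>N. off b b')" if "b \<in> N" for b
  proof -
    have "(\<Sum>b'\<in>N. off b b') = off b b + (\<Sum>b'\<in>N - {b}. off b b')"
      by (rule sum.remove[OF assms(1) that])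
    also have "(\<Sum>b'\<in>N - {b}. off b b') = K b"
      unfolding K_def by (intro sum.cong) (auto simp: off_def)
    finally show ?thesis by (simp add: off_def)
  qed
  have summand: "\<sigma> * Re (c b * cnj (c b') * H b b') \<ge>
      (if b = b' then (cmod (c b))\<^sup>2 * (\<sigma> * Re (H b b)) else 0)
      - ((cmod (c b))\<^sup>2 + (cmod (c b'))\<^sup>2) / 2 * off b b'" for b b'
  proof (cases "b = b'")
    case True
    have "c b * cnj (c b) = complex_of_real ((cmod (c b))\<^sup>2)"
      by (rule complex_norm_square[symmetric])
    then show ?thesis using True by (simp add: off_def)
  next
    case False
    have "\<bar>\<sigma> * Re (c b * cnj (c b') * H b b')\<bar> \<le> cmod (c b * cnj (c b') * H b b')"
      using abs_Re_le_cmod[of "c b * cnj (c b') * H b b'"] \<sigma> by (simp only: abs_mult mult_1)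
    also have "\<dots> = cmod (c b) * cmod (c b') * cmod (H b b')" by (simp add: norm_mult)
    also have "\<dots> \<le> ((cmod (c b))\<^sup>2 + (cmod (c b'))\<^sup>2) / 2 * cmod (H b b')"
      using sum_squares_bound[of "cmod (c b)" "cmod (c b')"] by (intro mult_right_mono) auto
    finally show ?thesis using False by (simp add: off_def abs_le_iff)
  qed
  have "H v v = (\<Sum>b\<in>N. c b * H b v)"
    by (subst (1) c) (simp add: sum_left scale_left)
  also have "\<dots> = (\<Sum>b\<in>N. \<Sum>b'\<in>N. c b * cnj (c b') * H b b')"
    by (subst c) (simp add: sum_right scale_right sum_distrib_left mult.assoc)
  finally have "Re (H v v) = (\<Sum>b\<in>N. \<Sum>b'\<in>N. Re (c b * cnj (c b') * H b b'))"
    by (simp only: Re_sum)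
  then have "\<sigma> * Re (H v v) = (\<Sum>b\<in>N. \<Sum>b'\<in>N. \<sigma> * Re (c b * cnj (c b') * H b b'))"
    by (simp only: sum_distrib_left)
  moreover have "\<dots> \<ge> (\<Sum>b\<in>N. \<Sum>b'\<in>N.
      (if b = b' then (cmod (c b))\<^sup>2 * (\<sigma> * Re (H b b)) else 0)
      - ((cmod (c b))\<^sup>2 + (cmod (c b'))\<^sup>2) / 2 * off b b')"
    by (intro sum_mono summand)
  moreover have "(\<Sum>b\<in>N. \<Sum>b'\<in>N.
      (if b = b' then (cmod (c b))\<^sup>2 * (\<sigma> * Re (H b b)) else 0)
      - ((cmod (c b))\<^sup>2 + (cmod (c b'))\<^sup>2) / 2 * off b b')
    = (\<Sum>b\<in>N. (cmod (c b))\<^sup>2 * (\<sigma> * Re (H b b) - K b))"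
  proof -
    have "(\<Sum>b\<in>N. \<Sum>b'\<in>N. (cmod (c b'))\<^sup>2 * off b b') = (\<Sum>b\<in>N. \<Sum>b'\<in>N. (cmod (c b))\<^sup>2 * off b b')"
      by (subst sum.swap) (simp add: off_sym)
    then have "(\<Sum>b\<in>N. \<Sum>b'\<in>N. ((cmod (c b))\<^sup>2 + (cmod (c b'))\<^sup>2) / 2 * off b b')
        = (\<Sum>b\<in>N. \<Sum>b'\<in>N. (cmod (c b))\<^sup>2 * off b b')"
      by (simp add: add_divide_distrib distrib_right sum.distrib sum_divide_distrib[symmetric])
    also have "\<dots> = (\<Sum>b\<in>N. (cmod (c b))\<^sup>2 * K b)"
      by (simp add: K_off sum_distrib_left)
    finally show ?thesis
      using assms(1) by (simp add: sum_subtractf right_diff_distrib)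
  qed
  moreover have "0 < (\<Sum>b\<in>N. (cmod (c b))\<^sup>2 * (\<sigma> * Re (H b b) - K b))"
    using dom b0 by (intro sum_pos2[OF assms(1) b0(1)])
      (auto simp: K_def less_imp_le)
  ultimately show ?thesis by linarith
qed

end

text \<open>
  At \<open>t0\<close> the off-diagonal entries vanish and the diagonal ones do not, so the Gram matrix stays
  diagonally dominant nearby.
\<close>

lemma definite_nearby:
  fixes scale :: "complex \<Rightarrow> 'b::ab_group_add \<Rightarrow> 'b"
    and H :: "real \<Rightarrow> 'b \<Rightarrow> 'b \<Rightarrow> complex"
  assumes form: "\<And>t. hermitian_form scale (H t)"
    and N: "finite N" "\<And>b b'. b \<in> N \<Longrightarrow> b' \<in> N \<Longrightarrow> continuous_on A (\<lambda>t. H t b b')"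
    and t0: "t0 \<in> A" "\<And>b b'. b \<in> N \<Longrightarrow> b' \<in> N \<Longrightarrow> b \<noteq> b' \<Longrightarrow> H t0 b b' = 0"
    and \<sigma>: "\<bar>\<sigma>\<bar> = 1" "\<And>b. b \<in> N \<Longrightarrow> 0 < \<sigma> * Re (H t0 b b)"
  obtains \<delta> where "\<delta> > 0"
    "\<And>t v. t \<in> A \<Longrightarrow> \<bar>t - t0\<bar> < \<delta> \<Longrightarrow> v \<in> module.span scale N \<Longrightarrow> v \<noteq> 0 \<Longrightarrow> 0 < \<sigma> * Re (H t v v)"
proof -
  define D where "D b t = \<sigma> * Re (H t b b) - (\<Sum>b'\<in>N - {b}. cmod (H t b b'))" for b t
  have D0: "0 < D b t0" if "b \<in> N" for b
  proof -
    have "(\<Sum>b'\<in>N - {b}. cmod (H t0 b b')) = 0" using t0(2) that by (intro sum.neutral) auto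
    then show ?thesis using \<sigma>(2)[OF that] by (simp add: D_def)
  qed
  have "eventually (\<lambda>t. 0 < D b t) (at t0 within A)" if "b \<in> N" for b
  proof -
    have "continuous_on A (D b)" unfolding D_def using N(2) that by (intro continuous_intros) auto
    then have "(D b \<longlongrightarrow> D b t0) (at t0 within A)" using t0(1) by (simp add: continuous_on_def)
    then show ?thesis using D0[OF that] by (rule order_tendstoD)
  qed
  then have "eventually (\<lambda>t. \<forall>b\<in>N. 0 < D b t) (at t0 within A)"
    using N(1) by (simp add: eventually_ball_finite)
  then obtain \<delta> where \<delta>: "\<delta> > 0" "\<And>t. t \<in> A \<Longrightarrow> t \<noteq> t0 \<Longrightarrow> dist t t0 < \<delta> \<Longrightarrow> \<forall>b\<in>N. 0 < D b t"
    by (auto simp: eventually_at)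
  have "0 < D b t" if "t \<in> A" "\<bar>t - t0\<bar> < \<delta>" "b \<in> N" for b t
    using \<delta>(2)[of t] that D0 by (cases "t = t0") (auto simp: dist_real_def)
  then show ?thesis
    using \<delta>(1) hermitian_form.definite_on_span_of_dominant[OF form N(1) \<sigma>(1)]
    by (intro that[of \<delta>]) (auto simp: D_def)
qed

text \<open>
  Let \<open>l j\<close> be the infimum of the parameters at which the form is nonpositive on some subspace of dimension
  \<open>j\<close>. At \<open>\<nu> = l j\<close> let \<open>n\<close> be the number of negative vectors in an orthogonal decomposition. If \<open>j \<le> n\<close>, then the
  form would still be negative on a subspace of dimension \<open>j\<close> slightly below \<open>\<nu>\<close>, against the choice of \<open>\<nu>\<close>;
  at \<open>\<nu> = 0\<close> there are no negative vectors. If \<open>j\<close> exceeded \<open>n\<close> plus the nullity, then at parameters slightly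
  above or equal to \<open>\<nu>\<close> a nonpositive subspace of dimension \<open>j\<close> would meet the span of the positive vectors, which
  is still positive definite there. So the indices \<open>j\<close> with \<open>l j = \<nu>\<close> number at most the nullity at \<open>\<nu>\<close>.
\<close>

theorem spectral_flow:
  fixes scale :: "complex \<Rightarrow> 'b::ab_group_add \<Rightarrow> 'b"
    and H :: "real \<Rightarrow> 'b \<Rightarrow> 'b \<Rightarrow> complex"
  assumes vs: "vector_space scale" and form: "\<And>t. hermitian_form scale (H t)"
    and "0 \<le> \<mu>"
    and V: "module.subspace scale V" "V \<subseteq> module.span scale T" "finite T"
    and cont: "\<And>u w. u \<in> V \<Longrightarrow> w \<in> V \<Longrightarrow> continuous_on {0..\<mu>} (\<lambda>t. H t u w)"
    and pos: "\<And>v. v \<in> V \<Longrightarrow> 0 \<le> Re (H 0 v v)"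
    and Q: "\<not> module.dependent scale Q" "Q \<subseteq> V"
      "\<And>v. v \<in> module.span scale Q \<Longrightarrow> Re (H \<mu> v v) \<le> 0"
  shows "\<exists>S. finite S \<and> S \<subseteq> {0..\<mu>} \<and>
    card Q \<le> (\<Sum>\<nu>\<in>S. vector_space.dim scale (hermitian_form.radical (H \<nu>) V))"
proof -
  interpret vector_space scale by fact
  define d where "d \<nu> = dim (hermitian_form.radical (H \<nu>) V)" for \<nu>
  have finQ: "finite Q"
    using independent_card_le_dim_of_finite_span[OF Q(1,2) V(2,3)] by simp
  define A where "A j = {t \<in> {0..\<mu>}. \<exists>P. independent P \<and> P \<subseteq> V \<and> card P = j \<and>
    (\<forall>v\<in>span P. Re (H t v v) \<le> 0)}" for j
  define l where "l j = Inf (A j)" for j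
  have \<mu>_A: "\<mu> \<in> A j" if j: "j \<le> card Q" for j
  proof -
    obtain P where P: "P \<subseteq> Q" "card P = j" by (rule obtain_subset_with_card_n[OF j])
    then have "independent P" "span P \<subseteq> span Q" using Q(1) independent_mono span_mono by blast+
    moreover from this have "\<forall>v\<in>span P. Re (H \<mu> v v) \<le> 0" using Q(3) by blast
    moreover have "P \<subseteq> V" using P Q(2) by blast
    ultimately show ?thesis using P(2) \<open>0 \<le> \<mu>\<close> unfolding A_def by auto
  qed
  have bdd: "bdd_below (A j)" for j by (rule bdd_belowI[of _ 0]) (auto simp: A_def)
  have l_in: "l j \<in> {0..\<mu>}" if "j \<le> card Q" for j
    using \<mu>_A[OF that] bdd[of j] unfolding l_def
    by (auto intro!: cInf_greatest cInf_lower simp: A_def)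
  \<comment> \<open>\<open>n\<close> is the number of negative vectors at \<open>\<nu>\<close>, the same for all \<open>j\<close> with \<open>l j = \<nu>\<close>\<close>
  have jump: "\<exists>n. \<forall>j\<in>{1..card Q}. l j = \<nu> \<longrightarrow> n < j \<and> j \<le> n + d \<nu>" if \<nu>: "\<nu> \<in> {0..\<mu>}" for \<nu>
  proof -
    interpret F: hermitian_form scale "H \<nu>" by (rule form)
    obtain N where N: "finite N" "N \<subseteq> V" "\<And>b. b \<in> N \<Longrightarrow> H \<nu> b b \<noteq> 0"
      "\<And>b b'. b \<in> N \<Longrightarrow> b' \<in> N \<Longrightarrow> b \<noteq> b' \<Longrightarrow> H \<nu> b b' = 0"
      "dim V \<le> card N + d \<nu>"
      using F.orthogonal_decomposition[OF V] unfolding d_def by blast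
    define Np where "Np = {b \<in> N. Re (H \<nu> b b) > 0}"
    define Nm where "Nm = {b \<in> N. Re (H \<nu> b b) < 0}"
    have fin: "finite Np" "finite Nm" using N(1) by (auto simp: Np_def Nm_def)
    have "Re (H \<nu> b b) \<noteq> 0" if "b \<in> N" for b
      using N(3)[OF that] F.diag_real[of b] by auto
    then have "N = Np \<union> Nm" "Np \<inter> Nm = {}" by (force simp: Np_def Nm_def)+
    then have cardN: "card N = card Np + card Nm" using fin by (simp add: card_Un_disjoint)
    have "independent N" using F.orthogonal_independent N by blast
    then have ind: "independent M" if "M \<subseteq> N" for M
      using that by (rule independent_mono)
    have sub: "Np \<subseteq> N" "Nm \<subseteq> N" by (auto simp: Np_def Nm_def)
    have contN: "continuous_on {0..\<mu>} (\<lambda>t. H t b b')" if "b \<in> N" "b' \<in> N" for b b'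
      using cont N(2) that by blast
    have near: "\<exists>\<delta>>0. \<forall>t\<in>{0..\<mu>}. \<bar>t - \<nu>\<bar> < \<delta> \<longrightarrow> (\<forall>v\<in>span M. v \<noteq> 0 \<longrightarrow> 0 < \<sigma> * Re (H t v v))"
      if M: "M \<subseteq> N" and \<sigma>: "\<bar>\<sigma>\<bar> = 1" "\<And>b. b \<in> M \<Longrightarrow> 0 < \<sigma> * Re (H \<nu> b b)" for M \<sigma>
    proof -
      have finM: "finite M" using M N(1) by (rule finite_subset)
      have contM: "continuous_on {0..\<mu>} (\<lambda>t. H t b b')" if "b \<in> M" "b' \<in> M" for b b'
        using contN M that by blast
      have orthM: "H \<nu> b b' = 0" if "b \<in> M" "b' \<in> M" "b \<noteq> b'" for b b'
        using N(4) M that by blast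
      show ?thesis
        by (rule definite_nearby[OF form finM contM \<nu> orthM \<sigma>]) blast+
    qed
    obtain \<delta>p where \<delta>p: "\<delta>p > 0" "\<And>t v. t \<in> {0..\<mu>} \<Longrightarrow> \<bar>t - \<nu>\<bar> < \<delta>p \<Longrightarrow> v \<in> span Np \<Longrightarrow> v \<noteq> 0 \<Longrightarrow>
        0 < Re (H t v v)"
      using near[OF sub(1), of 1] by (auto simp: Np_def)
    obtain \<delta>m where \<delta>m: "\<delta>m > 0" "\<And>t v. t \<in> {0..\<mu>} \<Longrightarrow> \<bar>t - \<nu>\<bar> < \<delta>m \<Longrightarrow> v \<in> span Nm \<Longrightarrow> v \<noteq> 0 \<Longrightarrow>
        Re (H t v v) < 0"
      using near[OF sub(2), of "-1"] by (auto simp: Nm_def)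
    have "card Nm < j \<and> j \<le> card Nm + d \<nu>" if j: "j \<in> {1..card Q}" and lj: "l j = \<nu>" for j
    proof
      have "Inf (A j) < \<nu> + \<delta>p" using lj \<delta>p(1) by (simp add: l_def)
      then obtain t where t: "t \<in> A j" "t < \<nu> + \<delta>p"
        using cInf_lessD[of "A j"] \<mu>_A[of j] j by auto
      have "\<nu> \<le> t" unfolding lj[symmetric] l_def using t bdd by (intro cInf_lower)
      obtain P where P: "independent P" "P \<subseteq> V" "card P = j" "\<forall>v\<in>span P. Re (H t v v) \<le> 0"
        using t(1) by (auto simp: A_def)
      have finP: "finite P" using independent_card_le_dim_of_finite_span[OF P(1,2) V(2,3)] by simp
      have t0: "t \<in> {0..\<mu>}" using t(1) by (simp add: A_def)
      have disj: "v = 0" if "v \<in> span P" "v \<in> span Np" for v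
        using P(4) \<delta>p(2)[OF t0 _ that(2)] that(1) t(2) \<open>\<nu> \<le> t\<close> by force
      have "independent (P \<union> Np)" "P \<inter> Np = {}"
        using independent_Un_of_spans_disjoint[OF P(1) finP ind[OF sub(1)] fin(1) disj] by blast+
      moreover have "P \<union> Np \<subseteq> V" using P N by (auto simp: Np_def)
      ultimately have "card (P \<union> Np) \<le> dim V"
        using independent_card_le_dim_of_finite_span V by blast
      then show "j \<le> card Nm + d \<nu>"
        using \<open>P \<inter> Np = {}\<close> finP fin N(5) cardN P(3) by (simp add: card_Un_disjoint)
    next
      show "card Nm < j"
      proof (rule ccontr)
        assume "\<not> card Nm < j"
        then have "j \<le> card Nm" by simp
        then obtain M where M: "M \<subseteq> Nm" "card M = j" by (rule obtain_subset_with_card_n)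
        obtain b where b: "b \<in> Nm" using M j by fastforce
        have "\<nu> \<noteq> 0" using pos[of b] b N(2) by (auto simp: Nm_def)
        define t where "t = max 0 (\<nu> - \<delta>m / 2)"
        have t: "t \<in> {0..\<mu>}" "\<bar>t - \<nu>\<bar> < \<delta>m" "t < \<nu>"
          using \<nu> \<open>\<nu> \<noteq> 0\<close> \<delta>m(1) by (auto simp: t_def)
        have "Re (H t v v) \<le> 0" if "v \<in> span M" for v
        proof (cases "v = 0")
          case True
          interpret Ft: hermitian_form scale "H t" by (rule form)
          show ?thesis using True by (simp add: Ft.zero_left)
        next
          case False
          then show ?thesis using \<delta>m(2)[OF t(1,2)] that span_mono[OF M(1)] by fastforce
        qed
        then have "t \<in> A j" using t M ind[of M] sub N(2) unfolding A_def by blast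
        then have "\<nu> \<le> t" unfolding lj[symmetric] l_def using bdd by (intro cInf_lower)
        then show False using t(3) by simp
      qed
    qed
    then show ?thesis by blast
  qed
  define S where "S = l ` {1..card Q}"
  have card_fiber: "card {j \<in> {1..card Q}. l j = \<nu>} \<le> d \<nu>" if "\<nu> \<in> S" for \<nu>
  proof -
    have "\<nu> \<in> {0..\<mu>}" using that l_in by (auto simp: S_def)
    from jump[OF this] obtain n where "\<forall>j\<in>{1..card Q}. l j = \<nu> \<longrightarrow> n < j \<and> j \<le> n + d \<nu>" by blast
    then have "{j \<in> {1..card Q}. l j = \<nu>} \<subseteq> {n<..n + d \<nu>}" by auto
    then have "card {j \<in> {1..card Q}. l j = \<nu>} \<le> card {n<..n + d \<nu>}" by (intro card_mono) auto
    then show ?thesis by simp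
  qed
  have "card Q = card (\<Union>\<nu>\<in>S. {j \<in> {1..card Q}. l j = \<nu>})"
  proof -
    have "(\<Union>\<nu>\<in>S. {j \<in> {1..card Q}. l j = \<nu>}) = {1..card Q}" by (auto simp: S_def)
    then show ?thesis by simp
  qed
  also have "\<dots> \<le> (\<Sum>\<nu>\<in>S. card {j \<in> {1..card Q}. l j = \<nu>})"
    by (intro card_UN_le) (simp add: S_def)
  also have "\<dots> \<le> (\<Sum>\<nu>\<in>S. d \<nu>)" by (intro sum_mono card_fiber)
  finally show ?thesis unfolding d_def
    by (intro exI[of _ S]) (use l_in in \<open>auto simp: S_def\<close>)
qed

section \<open>Trails and potentials in trees\<close>

lemma bidirected_simps [simp]:
  "verts (bidirected G) = verts G"
  "arcs (bidirected G) = arcs G \<times> UNIV"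
  "tail (bidirected G) a = (if snd a then tail G (fst a) else head G (fst a))"
  "head (bidirected G) a = (if snd a then head G (fst a) else tail G (fst a))"
  by (auto simp: bidirected_def split: prod.splits)

context metric_graph
begin

sublocale bi: wf_digraph "bidirected G"
  by unfold_locales auto

lemma telescope_walk:
  fixes f :: "'v \<Rightarrow> real"
  assumes "bi.awalk u p v"
  shows "(\<Sum>a\<leftarrow>p. f (head (bidirected G) a) - f (tail (bidirected G) a)) = f v - f u"
  using assms
  by (induction p arbitrary: u) (auto simp: bi.awalk_simps simp del: bidirected_simps)

text \<open>
  A discrete intermediate value theorem along the walk.
\<close>

lemma walk_crosses_level:
  fixes f :: "'v \<Rightarrow> real"
  assumes "bi.awalk u p v" "p \<noteq> []" "f u \<le> y" "y \<le> f v"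
  shows "\<exists>a\<in>set p. f (tail (bidirected G) a) \<le> y \<and> y \<le> f (head (bidirected G) a)"
  using assms
proof (induction p arbitrary: u)
  case (Cons a p)
  then have u: "u = tail (bidirected G) a" and p: "bi.awalk (head (bidirected G) a) p v"
    by (auto simp only: bi.awalk_Cons_iff)
  show ?case
  proof (cases "y \<le> f (head (bidirected G) a)")
    case True
    then show ?thesis using Cons.prems(3) u by auto
  next
    case False
    then have "p \<noteq> []" using p Cons.prems(4) bi.awalk_empty_ends by fastforce
    then show ?thesis using Cons.IH[OF p] False Cons.prems(4) by auto
  qed
qed simp

text \<open>
  An edge used twice, in either direction, would bring the walk back to the vertex where it was first entered.
\<close>

lemma apath_distinct_edges:
  assumes "bi.apath u p v"
  shows "distinct (map fst p)"
  using assms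
proof (induction p arbitrary: u)
  case (Cons a p)
  then have p: "bi.apath (head (bidirected G) a) p v"
    and u: "tail (bidirected G) a \<notin> set (bi.awalk_verts (head (bidirected G) a) p)"
    by (auto simp: bi.apath_Cons_iff simp del: bidirected_simps)
  have "fst b \<noteq> fst a" if b: "b \<in> set p" for b
  proof
    assume eq: "fst b = fst a"
    have "tail (bidirected G) a \<in> {tail (bidirected G) b, head (bidirected G) b}"
      using eq by auto
    moreover have "{tail (bidirected G) b, head (bidirected G) b} \<subseteq>
        set (bi.awalk_verts (head (bidirected G) a) p)"
      using bi.awalk_verts_arc1[OF b] bi.awalk_verts_arc2[OF bi.awalkI_apath[OF p] b]
      by (simp del: bidirected_simps)
    ultimately show False using u by blast
  qed
  then show ?case using Cons.IH[OF p] by force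
qed simp

lemma trail_length_le_card:
  assumes "bi.awalk u p v" "distinct (map fst p)"
  shows "length p \<le> card (arcs G)"
proof -
  have "set (map fst p) \<subseteq> arcs G" using assms(1) by (auto simp: bi.awalk_def)
  then have "card (set (map fst p)) \<le> card (arcs G)" by (intro card_mono) auto
  then show ?thesis using distinct_card[OF assms(2)] by simp
qed

lemma mg_path_lengths_nonneg:
  assumes "P \<in> mg_points G L" "Q \<in> mg_points G L" "l \<in> mg_path_lengths G L P Q"
  shows "0 \<le> l"
proof -
  have walk: "0 \<le> (\<Sum>a\<leftarrow>p. L (fst a))" if "bi.awalk u p v" for u p v
    using that length_pos by (intro sum_list_nonneg) (auto simp: bi.awalk_def less_imp_le)
  have exit: "0 \<le> r" if "(u, r) \<in> mg_exits G L R" "R \<in> mg_points G L" for u r R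
    using that by (auto simp: mg_exits_def mg_points_def split: prod.splits)
  from assms(3) consider "l = \<bar>snd P - snd Q\<bar>"
    | u r p v s where "l = r + (\<Sum>a\<leftarrow>p. L (fst a)) + s"
      "(u, r) \<in> mg_exits G L P" "(v, s) \<in> mg_exits G L Q" "bi.awalk u p v"
    unfolding mg_path_lengths_def by (auto split: if_splits)
  then show ?thesis
  proof cases
    case 2
    then show ?thesis using walk exit assms(1,2) by (metis add_nonneg_nonneg)
  qed simp
qed

text \<open>
  Path lengths are bounded below by 0, so the infimum that defines the distance is at most each of them.
\<close>

lemma mg_dist_le:
  assumes "P \<in> mg_points G L" "Q \<in> mg_points G L" "l \<in> mg_path_lengths G L P Q" "l \<le> c"
  shows "mg_dist G L P Q \<le> c"
proof -
  have "mg_dist G L P Q \<le> l"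
    unfolding mg_dist_def using mg_path_lengths_nonneg[OF assms(1,2)] assms(3)
    by (intro cInf_lower bdd_belowI[of _ 0]) auto
  then show ?thesis using assms(4) by simp
qed

end

locale metric_tree = metric_graph G L for G :: "('v, 'e) pre_digraph" and L +
  assumes tree: "graph_tree G"
begin

lemma walk_exists:
  assumes "u \<in> verts G" "v \<in> verts G"
  shows "\<exists>p. bi.awalk u p v"
proof -
  have "(u, v) \<in> rtrancl_on (verts G) (\<Union>e\<in>arcs G. {(tail G e, head G e), (head G e, tail G e)})"
    using tree assms
    by (simp add: graph_tree_def connected_def strongly_connected_def reachable_def parcs_mk_symmetric)
  then show ?thesis
  proof (induction rule: rtrancl_on.induct)
    case (rtrancl_on_refl a)
    then show ?case by (intro exI[of _ "[]"]) (simp add: bi.awalk_simps)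
  next
    case (rtrancl_on_into_rtrancl_on a b c)
    then obtain p where p: "bi.awalk a p b" by blast
    obtain e where "e \<in> arcs G" "(b, c) \<in> {(tail G e, head G e), (head G e, tail G e)}"
      using rtrancl_on_into_rtrancl_on by auto
    then have "bi.awalk b [(e, b = tail G e)] c" by (auto simp: bi.awalk_simps)
    then show ?case using p bi.awalk_appendI by blast
  qed
qed

text \<open>
  A walk between the ends of \<open>e\<close> that avoids \<open>e\<close> can be shortened to a path, and \<open>e\<close> closes that path to a cycle.
\<close>

lemma edge_is_bridge:
  assumes e: "e \<in> arcs G" and p: "bi.awalk (head G e) p (tail G e)"
  shows "e \<in> fst ` set p"
proof (rule ccontr)
  assume ne: "e \<notin> fst ` set p"
  let ?q = "bi.awalk_to_apath p"
  have q: "bi.apath (head G e) ?q (tail G e)" and sub: "set ?q \<subseteq> set p"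
    using bi.apath_awalk_to_apath[OF p] bi.awalk_to_apath_subset[OF p] by auto
  have "bi.cycle ((e, True) # ?q)"
    unfolding bi.cycle_def using e q
    by (intro exI[of _ "tail G e"]) (auto simp: bi.awalk_Cons_iff bi.apath_def)
  moreover have "distinct (map fst ((e, True) # ?q))"
    using apath_distinct_edges[OF q] sub ne by auto
  ultimately show False using tree by (auto simp: graph_tree_def graph_cycle_def)
qed

lemma no_loop: "e \<in> arcs G \<Longrightarrow> tail G e \<noteq> head G e"
  using edge_is_bridge[of e "[]"] by (auto simp: bi.awalk_simps)

text \<open>
  Removing the bridge \<open>e\<close> leaves a part \<open>beyond\<close> it, reachable from its head. Passing along an edge changes
  only the indicator of the part beyond that very edge, so the sum of these indicators with weights \<open>g\<close> has the
  required increments.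
\<close>

lemma potential_exists:
  fixes g :: "'e \<Rightarrow> real"
  shows "\<exists>\<psi>. \<forall>e\<in>arcs G. \<psi> (head G e) - \<psi> (tail G e) = g e"
proof -
  define beyond where "beyond e w \<longleftrightarrow> (\<exists>p. bi.awalk (head G e) p w \<and> e \<notin> fst ` set p)" for e w
  have step: "beyond e (head (bidirected G) a)"
    if a: "beyond e (tail (bidirected G) a)" "a \<in> arcs (bidirected G)" "fst a \<noteq> e" for e a
  proof -
    obtain p where "bi.awalk (head G e) p (tail (bidirected G) a)" "e \<notin> fst ` set p"
      using a(1) unfolding beyond_def by blast
    then have "bi.awalk (head G e) (p @ [a]) (head (bidirected G) a)" "e \<notin> fst ` set (p @ [a])"
      using bi.awalk_appendI bi.arc_implies_awalk a(2,3) by (blast, auto)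
    then show ?thesis unfolding beyond_def by blast
  qed
  have same: "beyond e (tail G a) \<longleftrightarrow> beyond e (head G a)" if "a \<in> arcs G" "a \<noteq> e" for e a
    using step[of e "(a, True)"] step[of e "(a, False)"] that by auto
  have ends: "beyond e (head G e)" "\<not> beyond e (tail G e)" if "e \<in> arcs G" for e
  proof -
    show "beyond e (head G e)"
      unfolding beyond_def using that by (intro exI[of _ "[]"]) (simp add: bi.awalk_simps)
    show "\<not> beyond e (tail G e)"
      using edge_is_bridge[OF that] by (auto simp: beyond_def)
  qed
  define \<psi> where "\<psi> w = (\<Sum>e\<in>arcs G. g e * of_bool (beyond e w))" for w
  have "\<psi> (head G a) - \<psi> (tail G a) = g a" if a: "a \<in> arcs G" for a
  proof -
    have "\<psi> (head G a) - \<psi> (tail G a) =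
        (\<Sum>e\<in>arcs G. g e * (of_bool (beyond e (head G a)) - of_bool (beyond e (tail G a))))"
      by (simp add: \<psi>_def sum_subtractf right_diff_distrib)
    also have "\<dots> = (\<Sum>e\<in>arcs G. if e = a then g a else 0)"
      using same a ends by (intro sum.cong) auto
    finally show ?thesis using a by simp
  qed
  then show ?thesis by blast
qed

text \<open>
  If the points lie on different edges, a path of fewest edges that joins an end of one to an end of the other
  avoids both edges, since otherwise a part of it would do. Adding the two edges gives a trail that contains
  a path between the points. On a common edge the edge itself is long enough.
\<close>

lemma distance_le_trail:
  assumes P: "P \<in> mg_points G L" and Q: "Q \<in> mg_points G L"
  obtains u p v where "p \<noteq> []" "bi.awalk u p v" "distinct (map fst p)"
    "mg_dist G L P Q \<le> (\<Sum>a\<leftarrow>p. L (fst a))"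
proof -
  obtain e x e' y where PQ: "P = (e, x)" "Q = (e', y)" by (cases P, cases Q)
  have e: "e \<in> arcs G" "0 \<le> x" "x \<le> L e" and e': "e' \<in> arcs G" "0 \<le> y" "y \<le> L e'"
    using P Q by (auto simp: PQ mg_points_def)
  show ?thesis
  proof (cases "e = e'")
    case True
    have "mg_dist G L P Q \<le> L e"
      by (rule mg_dist_le[OF P Q, of "\<bar>x - y\<bar>"]) (use True e e' in \<open>auto simp: PQ mg_path_lengths_def\<close>)
    then show ?thesis
      using e by (intro that[of "[(e, True)]" "tail G e" "head G e"]) (auto simp: bi.awalk_simps)
  next
    case False
    \<comment> \<open>the candidates for the connecting path; one of minimal length contains neither edge\<close>
    define W where "W p \<longleftrightarrow> (\<exists>u\<in>{tail G e, head G e}. \<exists>v\<in>{tail G e', head G e'}. bi.apath u p v)" for p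
    obtain p0 where "bi.awalk (tail G e) p0 (tail G e')"
      using walk_exists e(1) e'(1) by (metis tail_in_verts)
    then have "W (bi.awalk_to_apath p0)" unfolding W_def using bi.apath_awalk_to_apath by blast
    then obtain p where p: "W p" and min: "\<And>q. W q \<Longrightarrow> length p \<le> length q"
      using ex_has_least_nat[of W _ length] by blast
    then obtain u v where u: "u \<in> {tail G e, head G e}" and v: "v \<in> {tail G e', head G e'}"
      and path: "bi.apath u p v" by (auto simp: W_def)
    have walk: "bi.awalk u p v" using path by (rule bi.awalkI_apath)
    have ne: "fst a \<noteq> e" "fst a \<noteq> e'" if a: "a \<in> set p" for a
    proof -
      obtain p1 p2 where sp: "p = p1 @ a # p2" using split_list[OF a] by blast
      have 1: "bi.apath u p1 (tail (bidirected G) a)" "bi.apath (head (bidirected G) a) p2 v"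
        using path unfolding sp bi.apath_append_iff bi.apath_Cons_iff by auto
      show "fst a \<noteq> e"
      proof
        assume "fst a = e"
        then have "W p2" using 1(2) v by (auto simp: W_def split: if_splits)
        from min[OF this] show False by (simp add: sp)
      qed
      show "fst a \<noteq> e'"
      proof
        assume "fst a = e'"
        then have "W p1" using 1(1) u by (auto simp: W_def split: if_splits)
        from min[OF this] show False by (simp add: sp)
      qed
    qed
    define a where "a = (e, u = head G e)"
    define a' where "a' = (e', v = tail G e')"
    have aw: "bi.awalk (tail (bidirected G) a) [a] u"
      using bi.arc_implies_awalk[of a] u e by (auto simp: a_def split: if_splits)
    have aw': "bi.awalk v [a'] (head (bidirected G) a')"
      using bi.arc_implies_awalk[of a'] v e' by (auto simp: a'_def split: if_splits)
    have full: "bi.awalk (tail (bidirected G) a) ([a] @ p @ [a']) (head (bidirected G) a')"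
      using bi.awalk_appendI[OF aw bi.awalk_appendI[OF walk aw']] .
    have dist: "distinct (map fst ([a] @ p @ [a']))"
      using apath_distinct_edges[OF path] ne False by (force simp: a_def a'_def)
    have "\<exists>r. (u, r) \<in> mg_exits G L P \<and> r \<le> L e" using u e by (auto simp: mg_exits_def PQ)
    then obtain r where r: "(u, r) \<in> mg_exits G L P" "r \<le> L e" by blast
    have "\<exists>s. (v, s) \<in> mg_exits G L Q \<and> s \<le> L e'" using v e' by (auto simp: mg_exits_def PQ)
    then obtain s where s: "(v, s) \<in> mg_exits G L Q" "s \<le> L e'" by blast
    have "r + (\<Sum>b\<leftarrow>p. L (fst b)) + s \<in> mg_path_lengths G L P Q"
      unfolding mg_path_lengths_def using r s walk by blast
    then have "mg_dist G L P Q \<le> (\<Sum>b\<leftarrow>[a] @ p @ [a']. L (fst b))"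
      by (rule mg_dist_le[OF P Q]) (use r s in \<open>auto simp: a_def a'_def\<close>)
    then show ?thesis using that[OF _ full dist] by simp
  qed
qed

text \<open>
  Trails use each edge at most once, so there are only finitely many and one of them is longest. Positivity of
  the diameter is recorded because the bound divides by it: in a tree the ends of an edge are distinct vertices,
  hence their distance is at least the smallest edge length.
\<close>

lemma diameter_le_trail:
  obtains u p v where "p \<noteq> []" "bi.awalk u p v" "distinct (map fst p)"
    "0 < mg_diam G L" "mg_diam G L \<le> (\<Sum>a\<leftarrow>p. L (fst a))"
proof -
  define TR where "TR = {p. p \<noteq> [] \<and> distinct (map fst p) \<and> (\<exists>u v. bi.awalk u p v)}"
  define len where "len p = (\<Sum>a\<leftarrow>p. L (fst a))" for p :: "('e \<times> bool) list"
  have "TR \<subseteq> {p. set p \<subseteq> arcs G \<times> UNIV \<and> length p \<le> card (arcs G)}"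
    using trail_length_le_card by (auto simp: TR_def bi.awalk_def)
  moreover have "finite {p. set p \<subseteq> arcs G \<times> (UNIV :: bool set) \<and> length p \<le> card (arcs G)}"
    by (intro finite_lists_length_le) auto
  ultimately have fin: "finite TR" by (rule finite_subset)
  obtain e where e: "e \<in> arcs G" using has_edge by auto
  have "[(e, True)] \<in> TR" using e by (auto simp: TR_def bi.awalk_simps intro!: exI)
  then obtain p where p: "p \<in> TR" and max: "\<And>q. q \<in> TR \<Longrightarrow> len q \<le> len p"
    using obtains_MAX[OF fin, of len] Max_ge[OF finite_imageI[OF fin], of _ len] by (metis empty_iff imageI)
  have le: "mg_dist G L P Q \<le> len p" if PQ: "P \<in> mg_points G L" "Q \<in> mg_points G L" for P Q
  proof -
    obtain u q v where q: "q \<noteq> []" "bi.awalk u q v" "distinct (map fst q)" "mg_dist G L P Q \<le> len q"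
      unfolding len_def by (rule distance_le_trail[OF PQ])
    then have "q \<in> TR" unfolding TR_def by blast
    from max[OF this] q(4) show ?thesis by simp
  qed
  define DS where "DS = {mg_dist G L P Q | P Q. P \<in> mg_points G L \<and> Q \<in> mg_points G L}"
  have DS_le: "d \<le> len p" if "d \<in> DS" for d using le that by (auto simp: DS_def)
  have pts: "(e, 0) \<in> mg_points G L" "(e, L e) \<in> mg_points G L"
    using e length_pos[OF e] by (auto simp: mg_points_def)
  have mem: "mg_dist G L (e, 0) (e, L e) \<in> DS" unfolding DS_def using pts by blast
  have diam: "mg_diam G L \<le> len p"
    unfolding mg_diam_def DS_def[symmetric]
    using mem DS_le by (intro cSup_least) auto
  define m where "m = Min (L ` arcs G)"
  have m: "0 < m" "\<And>a. a \<in> arcs G \<Longrightarrow> m \<le> L a"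
    using has_edge length_pos by (auto simp: m_def)
  have "m \<le> l" if l: "l \<in> mg_path_lengths G L (e, 0) (e, L e)" for l
  proof -
    from l consider "l = \<bar>0 - L e\<bar>"
      | u r q v s where "l = r + (\<Sum>a\<leftarrow>q. L (fst a)) + s"
        "(u, r) \<in> mg_exits G L (e, 0)" "(v, s) \<in> mg_exits G L (e, L e)" "bi.awalk u q v"
      unfolding mg_path_lengths_def by auto
    then show ?thesis
    proof cases
      case 1
      then show ?thesis using m(2)[OF e] length_pos[OF e] by simp
    next
      case 2
      have nn: "0 \<le> (\<Sum>a\<leftarrow>q. L (fst a))" if "set q \<subseteq> arcs G \<times> UNIV" for q :: "('e \<times> bool) list"
        using that length_pos by (intro sum_list_nonneg) (auto simp: less_imp_le)
      have q: "set q \<subseteq> arcs G \<times> UNIV" using 2 by (auto simp: bi.awalk_def)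
      consider "u = tail G e" "v = head G e" "r = 0" "s = 0" | "L e \<le> r + s"
        using 2(2,3) length_pos[OF e] by (auto simp: mg_exits_def)
      then show ?thesis
      proof cases
        case 1
        then have "q \<noteq> []" using 2(4) no_loop[OF e] by (auto simp: bi.awalk_simps)
        then obtain a q' where q': "q = a # q'" by (cases q) auto
        then have "m \<le> L (fst a)" "0 \<le> (\<Sum>a\<leftarrow>q'. L (fst a))" using q nn m(2) by auto
        then show ?thesis using 2(1) 1 q' by simp
      next
        case 2
        then show ?thesis using \<open>l = r + (\<Sum>a\<leftarrow>q. L (fst a)) + s\<close> nn[OF q] m(2)[OF e] by linarith
      qed
    qed
  qed
  moreover have "mg_path_lengths G L (e, 0) (e, L e) \<noteq> {}" by (auto simp: mg_path_lengths_def)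
  ultimately have "m \<le> mg_dist G L (e, 0) (e, L e)"
    unfolding mg_dist_def by (intro cInf_greatest)
  also have "\<dots> \<le> mg_diam G L"
    unfolding mg_diam_def DS_def[symmetric]
    using mem DS_le by (intro cSup_upper bdd_aboveI[of _ "len p"]) auto
  finally have pos: "0 < mg_diam G L" using m(1) by simp
  obtain u v where uv: "p \<noteq> []" "bi.awalk u p v" "distinct (map fst p)"
    using p by (auto simp: TR_def)
  show ?thesis by (rule that[OF uv pos diam[unfolded len_def]])
qed

end

section \<open>Solutions of the eigenvalue equation on an interval\<close>

text \<open>
  The solutions of \<open>- f'' = t f\<close> with initial data \<open>(1, 0)\<close> and \<open>(0, 1)\<close>. The second one is normalised so that
  it depends continuously on \<open>t\<close> up to \<open>t = 0\<close>, where it is the identity.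
\<close>

definition sl_cos :: "real \<Rightarrow> real \<Rightarrow> real" where
  "sl_cos t x = cos (sqrt t * x)"

definition sl_sin :: "real \<Rightarrow> real \<Rightarrow> real" where
  "sl_sin t x = (if t = 0 then x else sin (sqrt t * x) / sqrt t)"

lemma sl_at_0 [simp]: "sl_cos t 0 = 1" "sl_sin t 0 = 0"
  by (auto simp: sl_cos_def sl_sin_def)

lemma sl_zero [simp]: "sl_cos 0 x = 1" "sl_sin 0 x = x"
  by (auto simp: sl_cos_def sl_sin_def)

lemma sl_cos_deriv:
  assumes "0 \<le> t"
  shows "(sl_cos t has_real_derivative - (t * sl_sin t x)) (at x within A)"
proof -
  have "sqrt t * sin (sqrt t * x) = t * sl_sin t x"
    using assms by (auto simp: sl_sin_def field_simps)
  then show ?thesis unfolding sl_cos_def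
    by (auto intro!: derivative_eq_intros simp: mult.commute)
qed

lemma sl_sin_deriv:
  assumes "0 \<le> t"
  shows "(sl_sin t has_real_derivative sl_cos t x) (at x within A)"
proof (cases "t = 0")
  case True
  then have "sl_sin t = (\<lambda>x. x)" by (auto simp: fun_eq_iff)
  then show ?thesis using True by simp
next
  case False
  then have "sl_sin t = (\<lambda>x. sin (sqrt t * x) / sqrt t)" by (auto simp: sl_sin_def fun_eq_iff)
  then show ?thesis using False assms
    by (auto simp: sl_cos_def field_simps intro!: derivative_eq_intros)
qed

lemma sl_pythagoras:
  assumes "0 \<le> t"
  shows "(sl_cos t x)\<^sup>2 + t * (sl_sin t x)\<^sup>2 = 1"
  using assms by (auto simp: sl_cos_def sl_sin_def power_divide)

lemma sl_cos_add:
  assumes "0 \<le> t"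
  shows "sl_cos t (x + y) = sl_cos t x * sl_cos t y - t * sl_sin t x * sl_sin t y"
  using assms by (auto simp: sl_cos_def sl_sin_def distrib_left cos_add)

lemma sl_sin_add: "sl_sin t (x + y) = sl_sin t x * sl_cos t y + sl_cos t x * sl_sin t y"
  by (auto simp: sl_cos_def sl_sin_def distrib_left sin_add add_divide_distrib)

lemma sl_minus [simp]: "sl_cos t (- x) = sl_cos t x" "sl_sin t (- x) = - sl_sin t x"
  by (auto simp: sl_cos_def sl_sin_def)

lemma sl_cos_diff:
  assumes "0 \<le> t"
  shows "sl_cos t (x - y) = sl_cos t x * sl_cos t y + t * sl_sin t x * sl_sin t y"
  using sl_cos_add[OF assms, of x "- y"] by simp

lemma sl_sin_diff: "sl_sin t (x - y) = sl_sin t x * sl_cos t y - sl_cos t x * sl_sin t y"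
  using sl_sin_add[of t x "- y"] by simp

lemma sl_three_term:
  fixes a b :: complex
  assumes "0 \<le> t"
  shows "a * sl_cos t (x + h) + b * sl_sin t (x + h) =
    2 * complex_of_real (sl_cos t h) * (a * sl_cos t x + b * sl_sin t x) - (a * sl_cos t (x - h) + b * sl_sin t (x - h))"
  by (simp add: sl_cos_add sl_cos_diff sl_sin_add sl_sin_diff assms algebra_simps)

lemma sl_sin_pos:
  assumes "0 \<le> t" "0 < x" "sqrt t * x < pi"
  shows "0 < sl_sin t x"
  using assms by (auto simp: sl_sin_def intro!: divide_pos_pos sin_gt_zero)

lemma sl_cos_continuous_parameter: "continuous_on A (\<lambda>t. sl_cos t x)"
  unfolding sl_cos_def by (intro continuous_intros)

text \<open>
  Written as \<open>x\<close> times the continuous extension of \<open>sin y / y\<close>, evaluated at \<open>\<surd>t x\<close>.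
\<close>

lemma sl_sin_continuous_parameter: "continuous_on {0..} (\<lambda>t. sl_sin t x)"
proof -
  define f where "f y = (if y = 0 then 1 else sin y / y)" for y :: real
  have "isCont f y" for y
  proof (cases "y = 0")
    case True
    have "((\<lambda>h. sin h / h) \<longlongrightarrow> 1) (at (0::real))"
      using DERIV_sin[of "0::real"] by (simp add: has_field_derivative_iff)
    then have "(f \<longlongrightarrow> 1) (at 0)"
      by (rule Lim_transform_eventually) (auto simp: eventually_at_filter f_def)
    then show ?thesis using True by (simp add: isCont_def f_def)
  next
    case False
    have cont: "isCont (\<lambda>y. sin y / y) y" using False by (intro continuous_intros) auto
    have "eventually (\<lambda>y. f y = sin y / y) (nhds y)"
      using t1_space_nhds[OF False] by (auto simp: f_def elim: eventually_mono)
    then have "isCont f y \<longleftrightarrow> isCont (\<lambda>y. sin y / y) y" by (rule isCont_cong)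
    from this cont show ?thesis by (rule iffD2)
  qed
  then have "continuous_on UNIV f" by (simp add: continuous_at_imp_continuous_on)
  then have "continuous_on {0..} (\<lambda>t. x * f (sqrt t * x))"
    by (intro continuous_on_mult continuous_on_const continuous_on_compose2[of UNIV f "{0..}" "\<lambda>t. sqrt t * x"]
        continuous_on_real_sqrt continuous_on_id) auto
  moreover have "x * f (sqrt t * x) = sl_sin t x" for t
    by (auto simp: f_def sl_sin_def)
  ultimately show ?thesis by simp
qed

lemma continuous_square_integrable:
  assumes "continuous_on {0..l} f"
  shows "square_integrable l f"
  unfolding square_integrable_def
  by (intro conjI continuous_imp_measurable_on_sets_lebesgue[OF assms] continuous_imp_integrable_real
      continuous_on_power continuous_on_norm[OF assms]) simp

text \<open>
  On a bounded interval \<open>|z| \<le> 1 + |z|\<^sup>2\<close> is an integrable bound.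
\<close>

lemma square_integrable_integrable:
  assumes "square_integrable l f"
  shows "integrable (lebesgue_on {0..l}) f"
proof (rule Bochner_Integration.integrable_bound)
  show "integrable (lebesgue_on {0..l}) (\<lambda>x. 1 + (cmod (f x))\<^sup>2)"
    using assms continuous_imp_integrable_real[of 0 l "\<lambda>_. 1::real"]
    by (auto simp: square_integrable_def)
  have "cmod z \<le> 1 + (cmod z)\<^sup>2" for z
    using zero_le_power2[of "cmod z - 1/2"] by (simp add: power2_diff power_divide)
  then show "AE x in lebesgue_on {0..l}. norm (f x) \<le> norm (1 + (cmod (f x))\<^sup>2)"
    by (intro AE_I2) (auto intro: order_trans[OF _ abs_ge_self])
qed (use assms in \<open>simp add: square_integrable_def\<close>)

lemma weak_derivative_continuous:
  assumes "has_weak_derivative l f g"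
  shows "continuous_on {0..l} f"
proof -
  have "continuous_on {0..l} (\<lambda>x. f 0 + integral\<^sup>L (lebesgue_on {0..x}) g)"
    using assms unfolding has_weak_derivative_def
    by (intro continuous_on_add continuous_on_const indefinite_integral_continuous_real
        square_integrable_integrable) blast
  then show ?thesis
    by (rule continuous_on_eq) (metis assms has_weak_derivative_def)
qed

text \<open>
  Together with the continuity of functions that have a weak derivative, this shows that eigenfunctions are
  classical solutions: \<open>- f'' = \<nu> f\<close> has a continuous right-hand side.
\<close>

lemma weak_derivative_vector_derivative:
  assumes f: "has_weak_derivative l f g" and g: "continuous_on {0..l} g" and x: "x \<in> {0..l}"
  shows "(f has_vector_derivative g x) (at x within {0..l})"
proof -
  have eq: "f y = f 0 + integral {0..y} g" if y: "y \<in> {0..l}" for y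
  proof -
    have "continuous_on {0..y} g" using g y by (auto intro: continuous_on_subset)
    then have "integral\<^sup>L (lebesgue_on {0..y}) g = integral {0..y} g"
      by (intro lebesgue_integral_eq_integral continuous_imp_integrable_real) auto
    then show ?thesis using f y unfolding has_weak_derivative_def by metis
  qed
  have "((\<lambda>y. f 0 + integral {0..y} g) has_vector_derivative g x) (at x within {0..l})"
    using integral_has_vector_derivative[OF g x] by (auto intro!: derivative_eq_intros)
  then show ?thesis by (rule has_vector_derivative_transform[OF x eq, rotated])
qed

lemma vector_derivative_weak_derivative:
  assumes f: "\<And>x. x \<in> {0..l} \<Longrightarrow> (f has_vector_derivative g x) (at x within {0..l})"
    and g: "continuous_on {0..l} g"
  shows "has_weak_derivative l f g"
proof -
  have "f x = f 0 + integral\<^sup>L (lebesgue_on {0..x}) g" if x: "x \<in> {0..l}" for x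
  proof -
    have sub: "{0..x} \<subseteq> {0..l}" using x by auto
    have "(g has_integral (f x - f 0)) {0..x}"
      using x f by (intro fundamental_theorem_of_calculus)
        (auto intro: has_vector_derivative_within_subset[OF _ sub])
    moreover have "integral\<^sup>L (lebesgue_on {0..x}) g = integral {0..x} g"
      using continuous_on_subset[OF g sub]
      by (intro lebesgue_integral_eq_integral continuous_imp_integrable_real) auto
    ultimately have "integral\<^sup>L (lebesgue_on {0..x}) g = f x - f 0" by (simp add: integral_unique)
    then show ?thesis by simp
  qed
  then show ?thesis using continuous_square_integrable[OF g] unfolding has_weak_derivative_def by blast
qed

definition solves_ode :: "real \<Rightarrow> real \<Rightarrow> (real \<Rightarrow> complex) \<Rightarrow> (real \<Rightarrow> complex) \<Rightarrow> bool" where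
  "solves_ode t l f g \<longleftrightarrow> (\<forall>x\<in>{0..l}.
     (f has_vector_derivative g x) (at x within {0..l}) \<and>
     (g has_vector_derivative - (complex_of_real t * f x)) (at x within {0..l}))"

lemma solves_ode_continuous:
  assumes "solves_ode t l f g"
  shows "continuous_on {0..l} f" "continuous_on {0..l} g"
  using assms unfolding solves_ode_def
  by (meson continuous_on_eq_continuous_within has_vector_derivative_continuous)+

lemma solves_ode_sl:
  fixes a b :: complex
  assumes "0 \<le> t"
  shows "solves_ode t l (\<lambda>x. a * sl_cos t x + b * sl_sin t x)
    (\<lambda>x. b * sl_cos t x - a * (t * sl_sin t x))"
  unfolding solves_ode_def of_real_mult
  by (auto intro!: derivative_eq_intros sl_cos_deriv[OF assms] sl_sin_deriv[OF assms]
      simp: algebra_simps)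

text \<open>
  Variation of constants: \<open>f C - g S\<close> and \<open>t f S + g C\<close>, where \<open>C\<close> and \<open>S\<close> are the two basic solutions, have
  derivative 0, and \<open>C\<^sup>2 + t S\<^sup>2 = 1\<close> recovers \<open>f\<close> from them.
\<close>

lemma solves_ode_unique:
  assumes t: "0 \<le> t" and sol: "solves_ode t l f g" and x: "x \<in> {0..l}"
  shows "f x = f 0 * sl_cos t x + g 0 * sl_sin t x"
proof -
  let ?C = "\<lambda>x. complex_of_real (sl_cos t x)" and ?S = "\<lambda>x. complex_of_real (sl_sin t x)"
  have fg: "(f has_vector_derivative g x) (at x within {0..l})"
    "(g has_vector_derivative - (t * f x)) (at x within {0..l})" if "x \<in> {0..l}" for x
    using sol that by (auto simp: solves_ode_def)
  have "((\<lambda>x. f x * ?C x - g x * ?S x) has_vector_derivative 0) (at x within {0..l})" if "x \<in> {0..l}" for x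
    by (auto intro!: derivative_eq_intros fg[OF that] sl_cos_deriv[OF t] sl_sin_deriv[OF t]
        simp: algebra_simps)
  then obtain c where c: "\<And>x. x \<in> {0..l} \<Longrightarrow> f x * ?C x - g x * ?S x = c"
    using has_vector_derivative_zero_constant[of "{0..l}"] by blast
  have "((\<lambda>x. t * f x * ?S x + g x * ?C x) has_vector_derivative 0) (at x within {0..l})" if "x \<in> {0..l}" for x
    by (auto intro!: derivative_eq_intros fg[OF that] sl_cos_deriv[OF t] sl_sin_deriv[OF t]
        simp: algebra_simps)
  then obtain d where d: "\<And>x. x \<in> {0..l} \<Longrightarrow> t * f x * ?S x + g x * ?C x = d"
    using has_vector_derivative_zero_constant[of "{0..l}"] by blast
  have "0 \<in> {0..l}" using x by auto
  have "c = f 0" "d = g 0" using c[OF \<open>0 \<in> {0..l}\<close>] d[OF \<open>0 \<in> {0..l}\<close>] by auto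
  have "f x * complex_of_real ((sl_cos t x)\<^sup>2 + t * (sl_sin t x)\<^sup>2)
      = (f x * ?C x - g x * ?S x) * ?C x + (t * f x * ?S x + g x * ?C x) * ?S x"
    by (simp add: algebra_simps power2_eq_square)
  also have "\<dots> = f 0 * ?C x + g 0 * ?S x" using c[OF x] d[OF x] \<open>c = f 0\<close> \<open>d = g 0\<close> by simp
  finally show ?thesis using sl_pythagoras[OF t] by simp
qed

section \<open>Eigenfunctions on a metric graph\<close>

lemma sum_fun_apply: "sum f A x = (\<Sum>a\<in>A. f a x)"
  by (induction A rule: infinite_finite_induct) auto

context metric_graph
begin

text \<open>
  The Sobolev description of eigenfunctions amounts to classical solutions on the edges that are continuous and
  satisfy the Kirchhoff condition at the vertices: such a solution and its first two derivatives are continuous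
  up to the ends of the edge.
\<close>

lemma eigenspace_iff:
  "f \<in> eigenspace G L \<nu> \<longleftrightarrow> f \<in> graph_funs G L \<and> continuous_at_vertices G L f \<and>
     (\<exists>g. (\<forall>e\<in>arcs G. solves_ode \<nu> (L e) (f e) (g e)) \<and>
       (\<forall>v\<in>verts G. (\<Sum>e\<in>{e \<in> arcs G. head G e = v}. g e (L e)) =
         (\<Sum>e\<in>{e \<in> arcs G. tail G e = v}. g e 0)))"
  (is "?l \<longleftrightarrow> ?r")
proof -
  have deriv: "edge_deriv L f e x = g e x"
    if "e \<in> arcs G" "solves_ode \<nu> (L e) (f e) (g e)" "x \<in> {0..L e}" for g e x
    unfolding edge_deriv_def using that length_pos[OF that(1)]
    by (intro vector_derivative_within_closed_interval) (auto simp: solves_ode_def)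
  have normal: "normal_deriv G L f v =
      (\<Sum>e\<in>{e \<in> arcs G. head G e = v}. g e (L e)) - (\<Sum>e\<in>{e \<in> arcs G. tail G e = v}. g e 0)"
    if "\<forall>e\<in>arcs G. solves_ode \<nu> (L e) (f e) (g e)" for g v
    unfolding normal_deriv_def using deriv that length_pos
    by (intro arg_cong2[where f="(-)"] sum.cong) (auto simp: less_imp_le)
  show ?thesis
  proof
    assume l: ?l
    then have *: "f \<in> laplacian_domain G L"
      "\<forall>e\<in>arcs G. \<exists>g. has_weak_derivative (L e) (f e) g \<and>
         has_weak_derivative (L e) g (\<lambda>x. - (\<nu> * f e x))"
      by (auto simp: eigenspace_def standard_laplacian_def gf_scale_def)
    from *(2) obtain g where g: "\<And>e. e \<in> arcs G \<Longrightarrow> has_weak_derivative (L e) (f e) (g e)"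
      "\<And>e. e \<in> arcs G \<Longrightarrow> has_weak_derivative (L e) (g e) (\<lambda>x. - (\<nu> * f e x))"
      by metis
    have sol: "solves_ode \<nu> (L e) (f e) (g e)" if e: "e \<in> arcs G" for e
    proof -
      have cont: "continuous_on {0..L e} (f e)" "continuous_on {0..L e} (g e)"
        using g[OF e] by (auto intro: weak_derivative_continuous)
      then have "continuous_on {0..L e} (\<lambda>x. - (complex_of_real \<nu> * f e x))"
        by (intro continuous_on_minus continuous_on_mult continuous_on_const)
      then show ?thesis unfolding solves_ode_def
        using weak_derivative_vector_derivative[OF g(1)[OF e] cont(2)]
          weak_derivative_vector_derivative[OF g(2)[OF e]]
        by blast
    qed
    then show ?r using * normal[of g]
      by (auto simp: laplacian_domain_def H1_def H_edgewise_def)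
  next
    assume r: ?r
    then obtain g where g: "\<And>e. e \<in> arcs G \<Longrightarrow> solves_ode \<nu> (L e) (f e) (g e)"
      "\<And>v. v \<in> verts G \<Longrightarrow> (\<Sum>e\<in>{e \<in> arcs G. head G e = v}. g e (L e)) =
         (\<Sum>e\<in>{e \<in> arcs G. tail G e = v}. g e 0)" by blast
    have weak: "has_weak_derivative (L e) (f e) (g e)"
      "has_weak_derivative (L e) (g e) (\<lambda>x. - (\<nu> * f e x))"
      "square_integrable (L e) (g e)" "square_integrable (L e) (\<lambda>x. - (\<nu> * f e x))"
      if e: "e \<in> arcs G" for e
    proof -
      note c = solves_ode_continuous[OF g(1)[OF e]]
      have c': "continuous_on {0..L e} (\<lambda>x. - (complex_of_real \<nu> * f e x))"
        using c(1) by (intro continuous_on_minus continuous_on_mult continuous_on_const)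
      show "has_weak_derivative (L e) (f e) (g e)"
        "has_weak_derivative (L e) (g e) (\<lambda>x. - (\<nu> * f e x))"
        using g(1)[OF e] c(2) c' unfolding solves_ode_def
        by (blast intro: vector_derivative_weak_derivative)+
      show "square_integrable (L e) (g e)" "square_integrable (L e) (\<lambda>x. - (\<nu> * f e x))"
        using c(2) c' by (blast intro: continuous_square_integrable)+
    qed
    have "f \<in> H1 G L" "f \<in> H_edgewise 2 G L"
      using r weak unfolding H1_def H_edgewise_def
      by (auto simp: numeral_2_eq_2) blast+
    moreover have "normal_deriv G L f v = 0" if "v \<in> verts G" for v
      using normal[of g v] g that by simp
    ultimately show ?l using r weak
      unfolding eigenspace_def standard_laplacian_def laplacian_domain_def
      by (auto simp: gf_scale_def graph_funs_def)
  qed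
qed

lemma sum_over_heads: "(\<Sum>e\<in>arcs G. h e (head G e)) = (\<Sum>v\<in>verts G. \<Sum>e\<in>{e \<in> arcs G. head G e = v}. h e v)"
proof -
  have "(\<Sum>v\<in>verts G. \<Sum>e\<in>{e \<in> arcs G. head G e = v}. h e v)
      = (\<Sum>v\<in>verts G. \<Sum>e\<in>{e \<in> arcs G. head G e = v}. h e (head G e))"
    by (intro sum.cong) auto
  also have "\<dots> = (\<Sum>e\<in>arcs G. h e (head G e))" by (intro sum.group) auto
  finally show ?thesis by simp
qed

lemma sum_over_tails: "(\<Sum>e\<in>arcs G. h e (tail G e)) = (\<Sum>v\<in>verts G. \<Sum>e\<in>{e \<in> arcs G. tail G e = v}. h e v)"
proof -
  have "(\<Sum>v\<in>verts G. \<Sum>e\<in>{e \<in> arcs G. tail G e = v}. h e v)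
      = (\<Sum>v\<in>verts G. \<Sum>e\<in>{e \<in> arcs G. tail G e = v}. h e (tail G e))"
    by (intro sum.cong) auto
  also have "\<dots> = (\<Sum>e\<in>arcs G. h e (tail G e))" by (intro sum.group) auto
  finally show ?thesis by simp
qed

text \<open>
  The operator is nonnegative. Instead of integrating by parts, consider \<open>\<phi> = Re (f' cnj f)\<close> on each edge. Its
  derivative \<open>|f'|\<^sup>2 - \<nu> |f|\<^sup>2\<close> is nonnegative, so \<open>\<phi>\<close> does not decrease along the edge; by continuity and the
  Kirchhoff condition at the vertices the increments over all edges add up to 0. So \<open>\<phi>\<close> is constant on each edge, its
  derivative vanishes, and \<open>f = 0\<close>.
\<close>

lemma negative_multiplicity:
  assumes "\<nu> < 0"
  shows "multiplicity G L \<nu> = 0"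
proof -
  have "f = 0" if f: "f \<in> eigenspace G L \<nu>" for f
  proof -
    from f obtain g where gf: "f \<in> graph_funs G L" "continuous_at_vertices G L f"
      and sol: "\<And>e. e \<in> arcs G \<Longrightarrow> solves_ode \<nu> (L e) (f e) (g e)"
      and kir: "\<And>v. v \<in> verts G \<Longrightarrow> (\<Sum>e\<in>{e \<in> arcs G. head G e = v}. g e (L e)) =
         (\<Sum>e\<in>{e \<in> arcs G. tail G e = v}. g e 0)"
      unfolding eigenspace_iff by blast
    from gf(2) obtain c where c: "\<And>e. e \<in> arcs G \<Longrightarrow> f e 0 = c (tail G e)"
      "\<And>e. e \<in> arcs G \<Longrightarrow> f e (L e) = c (head G e)"
      unfolding continuous_at_vertices_def by (metis head_in_verts tail_in_verts)
    define \<phi> where "\<phi> e x = Re (g e x * cnj (f e x))" for e x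
    define \<rho> where "\<rho> e x = (cmod (g e x))\<^sup>2 - \<nu> * (cmod (f e x))\<^sup>2" for e x
    have \<rho>0: "0 \<le> \<rho> e x" for e x
    proof -
      have "\<nu> * (cmod (f e x))\<^sup>2 \<le> 0" using assms by (intro mult_nonpos_nonneg) auto
      then show ?thesis unfolding \<rho>_def by (simp add: order_trans[of _ 0])
    qed
    have der: "(\<phi> e has_real_derivative \<rho> e x) (at x within {0..L e})"
      if e: "e \<in> arcs G" "x \<in> {0..L e}" for e x
    proof -
      have f': "(f e has_vector_derivative g e x) (at x within {0..L e})"
        and g': "(g e has_vector_derivative - (\<nu> * f e x)) (at x within {0..L e})"
        using sol[OF e(1)] e(2) by (auto simp: solves_ode_def)
      have "((\<lambda>x. Re (g e x * cnj (f e x))) has_vector_derivative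
          Re (g e x * cnj (g e x) + (- (\<nu> * f e x)) * cnj (f e x))) (at x within {0..L e})"
        by (intro bounded_linear.has_vector_derivative[OF bounded_linear_Re]
            has_vector_derivative_mult has_vector_derivative_cnj f' g')
      moreover have "Re (g e x * cnj (g e x) + (- (\<nu> * f e x)) * cnj (f e x)) = \<rho> e x"
        by (simp add: \<rho>_def cmod_power2) (simp add: power2_eq_square algebra_simps)
      ultimately show ?thesis
        by (simp add: \<phi>_def[abs_def] has_real_derivative_iff_has_vector_derivative)
    qed
    have mono: "\<phi> e x \<le> \<phi> e y" if e: "e \<in> arcs G" and xy: "0 \<le> x" "x \<le> y" "y \<le> L e" for e x y
    proof (rule DERIV_nonneg_imp_increasing_open[OF xy(2)])
      show "continuous_on {x..y} (\<phi> e)"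
        using xy by (intro continuous_on_subset[OF DERIV_continuous_on[OF der[OF e]]]) auto
      show "\<exists>d. (\<phi> e has_real_derivative d) (at z) \<and> 0 \<le> d" if "x < z" "z < y" for z
      proof -
        have "at z within {0..L e} = at z" using that xy by (intro at_within_Icc_at) auto
        then show ?thesis using der[OF e, of z] \<rho>0 that xy by auto
      qed
    qed
    \<comment> \<open>grouping the boundary terms by vertices, where \<open>f\<close> has a single value \<open>c v\<close>\<close>
    have "(\<Sum>e\<in>arcs G. \<phi> e (L e) - \<phi> e 0) = 0"
    proof -
      have "(\<Sum>e\<in>arcs G. g e (L e) * cnj (f e (L e))) = (\<Sum>e\<in>arcs G. g e (L e) * cnj (c (head G e)))"
        by (intro sum.cong) (auto simp: c)
      also have "\<dots> = (\<Sum>v\<in>verts G. (\<Sum>e\<in>{e \<in> arcs G. head G e = v}. g e (L e)) * cnj (c v))"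
        by (subst sum_over_heads[of "\<lambda>e v. g e (L e) * cnj (c v)"]) (simp add: sum_distrib_right)
      also have "\<dots> = (\<Sum>v\<in>verts G. (\<Sum>e\<in>{e \<in> arcs G. tail G e = v}. g e 0) * cnj (c v))"
        by (intro sum.cong) (auto simp: kir)
      also have "\<dots> = (\<Sum>e\<in>arcs G. g e 0 * cnj (c (tail G e)))"
        by (subst sum_over_tails[of "\<lambda>e v. g e 0 * cnj (c v)"]) (simp add: sum_distrib_right)
      also have "\<dots> = (\<Sum>e\<in>arcs G. g e 0 * cnj (f e 0))"
        by (intro sum.cong) (auto simp: c)
      finally have "Re (\<Sum>e\<in>arcs G. g e (L e) * cnj (f e (L e))) = Re (\<Sum>e\<in>arcs G. g e 0 * cnj (f e 0))"
        by (rule arg_cong)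
      then show ?thesis by (simp only: \<phi>_def sum_subtractf Re_sum)
    qed
    moreover have "0 \<le> \<phi> e (L e) - \<phi> e 0" if "e \<in> arcs G" for e
      using mono[OF that, of 0 "L e"] length_pos[OF that] by simp
    ultimately have ends: "\<phi> e (L e) = \<phi> e 0" if "e \<in> arcs G" for e
      using that by (simp add: sum_nonneg_eq_0_iff)
    have "f e x = 0" for e x
    proof (cases "e \<in> arcs G \<and> x \<in> {0..L e}")
      case True
      then have e: "e \<in> arcs G" and x: "x \<in> {0..L e}" by auto
      have const: "\<phi> e 0 = \<phi> e y" if "y \<in> {0..L e}" for y
        using mono[OF e, of 0 y] mono[OF e, of y "L e"] ends[OF e] that by force
      have "(\<phi> e has_real_derivative 0) (at x within {0..L e})"
        by (rule has_field_derivative_transform_within[of "\<lambda>_. \<phi> e 0" 0 x "{0..L e}" 1, OF _ _ x const]) auto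
      then have "\<rho> e x = 0"
        using der[OF e x] vector_derivative_unique_within_closed_interval[of 0 "L e" x "\<phi> e" "\<rho> e x" 0]
          length_pos[OF e] x by (simp add: has_real_derivative_iff_has_vector_derivative)
      moreover have "0 \<le> - \<nu> * (cmod (f e x))\<^sup>2" using assms by (intro mult_nonneg_nonneg) auto
      ultimately have "\<nu> * (cmod (f e x))\<^sup>2 = 0"
        unfolding \<rho>_def by (smt (verit) zero_le_power2 mult_minus_left)
      then show ?thesis using assms by simp
    next
      case False
      then show ?thesis using gf(1) by (auto simp: graph_funs_def)
    qed
    then show "f = 0" by (auto simp: fun_eq_iff)
  qed
  then have "eigenspace G L \<nu> \<subseteq> graph_fun.span {}" by auto
  from graph_fun.dim_le_card[OF this] show ?thesis by (simp add: multiplicity_def)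
qed

text \<open>
  On each edge an eigenfunction combines the two basic solutions. Finiteness matters since \<open>dim\<close> is 0, by
  convention, for a space of infinite dimension.
\<close>

lemma eigenspace_finite_span:
  assumes "0 \<le> \<nu>"
  obtains T where "finite T" "eigenspace G L \<nu> \<subseteq> graph_fun.span T"
proof -
  define bC where "bC e = (\<lambda>e' x. if e' = e \<and> x \<in> {0..L e} then complex_of_real (sl_cos \<nu> x) else 0)" for e
  define bS where "bS e = (\<lambda>e' x. if e' = e \<and> x \<in> {0..L e} then complex_of_real (sl_sin \<nu> x) else 0)" for e
  define T where "T = bC ` arcs G \<union> bS ` arcs G"
  have "f \<in> graph_fun.span T" if f: "f \<in> eigenspace G L \<nu>" for f
  proof -
    from f obtain g where gf: "f \<in> graph_funs G L"
      and sol: "\<And>e. e \<in> arcs G \<Longrightarrow> solves_ode \<nu> (L e) (f e) (g e)"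
      unfolding eigenspace_iff by blast
    have "f e x = (\<Sum>e'\<in>arcs G. gf_scale (f e' 0) (bC e') + gf_scale (g e' 0) (bS e')) e x" for e x
    proof -
      have "(\<Sum>e'\<in>arcs G. gf_scale (f e' 0) (bC e') + gf_scale (g e' 0) (bS e')) e x
          = (\<Sum>e'\<in>arcs G. if e' = e then (if x \<in> {0..L e}
              then f e 0 * sl_cos \<nu> x + g e 0 * sl_sin \<nu> x else 0) else 0)"
        unfolding sum_fun_apply by (intro sum.cong) (auto simp: gf_scale_def bC_def bS_def)
      also have "\<dots> = (if e \<in> arcs G \<and> x \<in> {0..L e}
              then f e 0 * sl_cos \<nu> x + g e 0 * sl_sin \<nu> x else 0)"
        by simp
      also have "\<dots> = f e x"
      proof (cases "e \<in> arcs G \<and> x \<in> {0..L e}")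
        case True
        then show ?thesis using solves_ode_unique[OF assms sol, of e x] by metis
      next
        case False
        then show ?thesis using gf by (auto simp: graph_funs_def)
      qed
      finally show ?thesis by (rule sym)
    qed
    then have "f = (\<Sum>e'\<in>arcs G. gf_scale (f e' 0) (bC e') + gf_scale (g e' 0) (bS e'))"
      by (intro ext)
    also have "\<dots> \<in> graph_fun.span T"
      by (intro graph_fun.span_sum graph_fun.span_add graph_fun.span_scale graph_fun.span_base)
        (auto simp: T_def)
    finally show ?thesis .
  qed
  then show ?thesis by (intro that[of T]) (auto simp: T_def)
qed

text \<open>
  The infimum that defines \<open>eigval\<close> is over a set bounded below, since there are no negative eigenvalues.
\<close>

lemma eigval_le:
  assumes S: "finite S" "S \<subseteq> {..\<mu>}" "k \<le> (\<Sum>\<nu>\<in>S. multiplicity G L \<nu>)" and k: "1 \<le> k"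
  shows "eigval G L k \<le> \<mu>"
proof -
  have "0 \<le> \<mu>'" if S': "S' \<subseteq> {..\<mu>'}" "k \<le> (\<Sum>\<nu>\<in>S'. multiplicity G L \<nu>)" for \<mu>' S'
  proof (rule ccontr)
    assume "\<not> 0 \<le> \<mu>'"
    then have "(\<Sum>\<nu>\<in>S'. multiplicity G L \<nu>) = 0"
      using S'(1) by (intro sum.neutral ballI negative_multiplicity) auto
    then show False using S'(2) k by simp
  qed
  then show ?thesis
    unfolding eigval_def using S by (intro cInf_lower bdd_belowI[of _ 0]) auto
qed

end

section \<open>Reduction to node values\<close>

text \<open>
  Values at the nodes: \<open>u e i\<close> is the value at the point \<open>i L(e) / n\<close> of the edge \<open>e\<close>, for \<open>i \<le> n\<close>. A vertex
  is represented once for each edge end at it, as in the definition of points of the graph.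
\<close>

definition nf_scale :: "complex \<Rightarrow> ('e \<Rightarrow> nat \<Rightarrow> complex) \<Rightarrow> 'e \<Rightarrow> nat \<Rightarrow> complex" where
  "nf_scale c u = (\<lambda>e i. c * u e i)"

interpretation nodal: vector_space nf_scale
  by unfold_locales (auto simp: nf_scale_def fun_eq_iff algebra_simps)

text \<open>
  The energy \<open>\<integral>|f'|\<^sup>2 - t \<integral>|f|\<^sup>2\<close> on a piece of length \<open>h\<close>, polarized, as a form in the end values \<open>a\<close>, \<open>b\<close> of the
  solution \<open>f\<close> of \<open>- f'' = t f\<close>. After integration by parts only boundary terms remain, and the derivatives of \<open>f\<close>
  at the ends are \<open>(b - a cos) / sin\<close> and \<open>(b cos - a) / sin\<close> in terms of the basic solutions at \<open>h\<close>.
\<close>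

definition piece_form ::
    "real \<Rightarrow> real \<Rightarrow> complex \<Rightarrow> complex \<Rightarrow> complex \<Rightarrow> complex \<Rightarrow> complex" where
  "piece_form t h a b a' b' =
     ((complex_of_real (sl_cos t h) * a - b) * cnj a' + (complex_of_real (sl_cos t h) * b - a) * cnj b')
       / complex_of_real (sl_sin t h)"

context metric_graph
begin

definition nodal_space :: "nat \<Rightarrow> ('e \<Rightarrow> nat \<Rightarrow> complex) set" where
  "nodal_space n = {u. (\<forall>e i. e \<notin> arcs G \<or> n < i \<longrightarrow> u e i = 0) \<and>
     (\<forall>v\<in>verts G. \<exists>c. \<forall>e\<in>arcs G. (tail G e = v \<longrightarrow> u e 0 = c) \<and> (head G e = v \<longrightarrow> u e n = c))}"

definition nodal_form :: "nat \<Rightarrow> real \<Rightarrow> ('e \<Rightarrow> nat \<Rightarrow> complex) \<Rightarrow> ('e \<Rightarrow> nat \<Rightarrow> complex) \<Rightarrow> complex" where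
  "nodal_form n t u w =
     (\<Sum>e\<in>arcs G. \<Sum>i<n. piece_form t (L e / n) (u e i) (u e (Suc i)) (w e i) (w e (Suc i)))"

lemma nodal_form_hermitian: "hermitian_form nf_scale (nodal_form n t)"
proof
  show "nodal_form n t (u + v) w = nodal_form n t u w + nodal_form n t v w" for u v w
    unfolding nodal_form_def sum.distrib[symmetric]
    by (intro sum.cong refl) (simp add: piece_form_def field_simps add_divide_distrib[symmetric])
  show "nodal_form n t (nf_scale c u) w = c * nodal_form n t u w" for c u w
    unfolding nodal_form_def sum_distrib_left
    by (intro sum.cong refl) (simp add: piece_form_def nf_scale_def field_simps)
  show "nodal_form n t w u = cnj (nodal_form n t u w)" for u w
    unfolding nodal_form_def cnj_sum
    by (intro sum.cong refl) (simp add: piece_form_def field_simps)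
qed

lemma nodal_space_subspace: "nodal.subspace (nodal_space n)"
proof (rule nodal.subspaceI)
  show "0 \<in> nodal_space n" by (auto simp: nodal_space_def)
  show "u + w \<in> nodal_space n" if uw: "u \<in> nodal_space n" "w \<in> nodal_space n" for u w
  proof -
    have "\<exists>c. \<forall>e\<in>arcs G. (tail G e = v \<longrightarrow> (u + w) e 0 = c) \<and> (head G e = v \<longrightarrow> (u + w) e n = c)"
      if v: "v \<in> verts G" for v
    proof -
      obtain a b where "\<forall>e\<in>arcs G. (tail G e = v \<longrightarrow> u e 0 = a) \<and> (head G e = v \<longrightarrow> u e n = a)"
        "\<forall>e\<in>arcs G. (tail G e = v \<longrightarrow> w e 0 = b) \<and> (head G e = v \<longrightarrow> w e n = b)"
        using uw v unfolding nodal_space_def by blast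
      then show ?thesis by (intro exI[of _ "a + b"]) simp
    qed
    then show ?thesis using uw by (simp add: nodal_space_def)
  qed
  show "nf_scale c u \<in> nodal_space n" if u: "u \<in> nodal_space n" for c u
  proof -
    have "\<exists>b. \<forall>e\<in>arcs G. (tail G e = v \<longrightarrow> nf_scale c u e 0 = b) \<and> (head G e = v \<longrightarrow> nf_scale c u e n = b)"
      if v: "v \<in> verts G" for v
    proof -
      obtain a where "\<forall>e\<in>arcs G. (tail G e = v \<longrightarrow> u e 0 = a) \<and> (head G e = v \<longrightarrow> u e n = a)"
        using u v unfolding nodal_space_def by blast
      then show ?thesis by (intro exI[of _ "c * a"]) (simp add: nf_scale_def)
    qed
    then show ?thesis using u by (simp add: nodal_space_def nf_scale_def)
  qed
qed

lemma nodal_space_finite_span: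
  obtains T where "finite T" "nodal_space n \<subseteq> nodal.span T"
proof -
  define d :: "'e \<times> nat \<Rightarrow> 'e \<Rightarrow> nat \<Rightarrow> complex" where
    "d = (\<lambda>(e, i) e' j. of_bool (e' = e \<and> j = i))"
  define T where "T = d ` (arcs G \<times> {..n})"
  have "u \<in> nodal.span T" if u: "u \<in> nodal_space n" for u
  proof -
    have "u = (\<Sum>p\<in>arcs G \<times> {..n}. nf_scale (u (fst p) (snd p)) (d p))"
    proof (intro ext)
      fix e j
      have "(\<Sum>p\<in>arcs G \<times> {..n}. nf_scale (u (fst p) (snd p)) (d p)) e j
          = (\<Sum>p\<in>arcs G \<times> {..n}. if p = (e, j) then u e j else 0)"
        unfolding sum_fun_apply
      proof (intro sum.cong refl)
        fix p :: "'e \<times> nat"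
        show "nf_scale (u (fst p) (snd p)) (d p) e j = (if p = (e, j) then u e j else 0)"
          by (cases p) (auto simp: d_def nf_scale_def)
      qed
      also have "\<dots> = (if (e, j) \<in> arcs G \<times> {..n} then u e j else 0)"
        by (rule sum.delta) simp
      also have "\<dots> = u e j" using u by (auto simp: nodal_space_def not_le)
      finally show "u e j = (\<Sum>p\<in>arcs G \<times> {..n}. nf_scale (u (fst p) (snd p)) (d p)) e j"
        by (rule sym)
    qed
    also have "\<dots> \<in> nodal.span T"
      by (intro nodal.span_sum nodal.span_scale nodal.span_base) (auto simp: T_def)
    finally show ?thesis .
  qed
  then show ?thesis by (intro that[of T]) (auto simp: T_def)
qed

lemma nodal_form_continuous:
  assumes pos: "\<And>t e. t \<in> {0..\<mu>} \<Longrightarrow> e \<in> arcs G \<Longrightarrow> 0 < sl_sin t (L e / n)"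
  shows "continuous_on {0..\<mu>} (\<lambda>t. nodal_form n t u w)"
proof -
  have S: "continuous_on {0..\<mu>} (\<lambda>t. complex_of_real (sl_sin t x))" for x
    by (intro continuous_on_of_real continuous_on_subset[OF sl_sin_continuous_parameter]) auto
  have C: "continuous_on {0..\<mu>} (\<lambda>t. complex_of_real (sl_cos t x))" for x
    by (intro continuous_on_of_real sl_cos_continuous_parameter)
  have nz: "\<forall>t\<in>{0..\<mu>}. complex_of_real (sl_sin t (L e / n)) \<noteq> 0" if "e \<in> arcs G" for e
    using pos[OF _ that] by force
  show ?thesis
    unfolding nodal_form_def piece_form_def
    by (intro continuous_on_sum continuous_on_divide continuous_on_add continuous_on_mult
        continuous_on_diff continuous_on_const C S nz)
qed

lemma nodal_form_nonneg_at_0: "0 \<le> Re (nodal_form n 0 u u)"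
proof -
  have "0 \<le> Re (piece_form 0 (L e / n) a b a b)" if "e \<in> arcs G" for e a b
  proof -
    have "piece_form 0 (L e / n) a b a b = complex_of_real ((cmod (a - b))\<^sup>2 / (L e / n))"
      unfolding piece_form_def of_real_divide complex_norm_square by (simp add: algebra_simps)
    then have "Re (piece_form 0 (L e / n) a b a b) = (cmod (a - b))\<^sup>2 / (L e / n)" by simp
    then show ?thesis using length_pos[OF that] by simp
  qed
  then show ?thesis unfolding nodal_form_def Re_sum by (intro sum_nonneg) auto
qed

text \<open>
  On the first piece this is the solution of \<open>- f'' = t f\<close> with end values \<open>u e 0\<close> and \<open>u e 1\<close>, continued to the
  whole edge.
\<close>

definition trig_extension :: "nat \<Rightarrow> real \<Rightarrow> ('e \<Rightarrow> nat \<Rightarrow> complex) \<Rightarrow> 'e graph_fun" where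
  "trig_extension n t u = (\<lambda>e x. if e \<in> arcs G \<and> x \<in> {0..L e}
     then u e 0 * sl_cos t x
       + (u e 1 - complex_of_real (sl_cos t (L e / n)) * u e 0) / complex_of_real (sl_sin t (L e / n)) * sl_sin t x
     else 0)"

text \<open>
  For a test vector supported at the ends of edges, only the first and the last piece of each edge contribute,
  each a difference quotient that stands for the derivative there.
\<close>

lemma nodal_form_delta:
  assumes n: "1 \<le> n" and w: "\<And>e i. e \<in> arcs G \<Longrightarrow> i \<le> n \<Longrightarrow> w e i = of_bool (i = 0 \<and> P e \<or> i = n \<and> R e)"
  shows "nodal_form n t u w = (\<Sum>e\<in>arcs G.
     (of_bool (P e) * (complex_of_real (sl_cos t (L e / n)) * u e 0 - u e 1) +
      of_bool (R e) * (complex_of_real (sl_cos t (L e / n)) * u e n - u e (n - 1))) / complex_of_real (sl_sin t (L e / n)))"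
  unfolding nodal_form_def
proof (intro sum.cong refl)
  fix e assume e: "e \<in> arcs G"
  let ?c = "complex_of_real (sl_cos t (L e / n))" and ?S = "complex_of_real (sl_sin t (L e / n))"
  have piece: "piece_form t (L e / n) (u e i) (u e (Suc i)) (w e i) (w e (Suc i))
      = (if i = 0 then of_bool (P e) * (?c * u e 0 - u e 1) / ?S else 0)
         + (if i = n - 1 then of_bool (R e) * (?c * u e n - u e (n - 1)) / ?S else 0)" if i: "i < n" for i
  proof -
    have 1: "w e i = of_bool (i = 0 \<and> P e)" using w[OF e, of i] i by simp
    have "Suc i = n \<longleftrightarrow> i = n - 1" using n by auto
    then have 2: "w e (Suc i) = of_bool (i = n - 1 \<and> R e)" using w[OF e, of "Suc i"] i by simp
    have 3: "u e (Suc (n - 1)) = u e n" using n by simp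
    show ?thesis
    proof (cases "n = 1")
      case True
      then show ?thesis using i unfolding piece_form_def 1 2 by (simp add: add_divide_distrib)
    next
      case False
      then have "n - 1 \<noteq> 0" using n by simp
      then show ?thesis
        unfolding piece_form_def 1 2 by (cases "i = 0"; cases "i = n - 1") (simp_all add: 3)
    qed
  qed
  have "(\<Sum>i<n. piece_form t (L e / n) (u e i) (u e (Suc i)) (w e i) (w e (Suc i)))
      = (\<Sum>i<n. (if i = 0 then of_bool (P e) * (?c * u e 0 - u e 1) / ?S else 0)
         + (if i = n - 1 then of_bool (R e) * (?c * u e n - u e (n - 1)) / ?S else 0))"
    by (intro sum.cong refl piece) simp
  also have "\<dots> = of_bool (P e) * (?c * u e 0 - u e 1) / ?S
      + of_bool (R e) * (?c * u e n - u e (n - 1)) / ?S"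
    using n by (simp add: sum.distrib)
  finally show "(\<Sum>i<n. piece_form t (L e / n) (u e i) (u e (Suc i)) (w e i) (w e (Suc i)))
      = (of_bool (P e) * (?c * u e 0 - u e 1) + of_bool (R e) * (?c * u e n - u e (n - 1))) / ?S"
    by (simp add: add_divide_distrib)
qed

text \<open>
  Testing with the delta function at an inner node. The relation says that the derivatives of the two solutions
  on the adjacent pieces agree there, and is the three-term recurrence satisfied by a single solution on an
  equidistant grid.
\<close>

lemma radical_three_term:
  assumes u: "\<And>w. w \<in> nodal_space n \<Longrightarrow> nodal_form n t u w = 0"
    and e: "e \<in> arcs G" and S: "sl_sin t (L e / n) \<noteq> 0" and i: "Suc i < n"
  shows "u e (Suc (Suc i)) = 2 * complex_of_real (sl_cos t (L e / n)) * u e (Suc i) - u e i"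
proof -
  define w :: "'e \<Rightarrow> nat \<Rightarrow> complex" where "w = (\<lambda>e' j. of_bool (e' = e \<and> j = Suc i))"
  let ?c = "complex_of_real (sl_cos t (L e / n))" and ?S = "complex_of_real (sl_sin t (L e / n))"
  have "w \<in> nodal_space n" using e i by (auto simp: nodal_space_def w_def intro!: exI[of _ 0])
  then have "0 = nodal_form n t u w" using u by simp
  also have "\<dots> = (\<Sum>e'\<in>arcs G. if e' = e then (\<Sum>j<n. piece_form t (L e / n) (u e j) (u e (Suc j)) (w e j) (w e (Suc j))) else 0)"
    unfolding nodal_form_def by (intro sum.cong refl) (auto simp: w_def piece_form_def)
  also have "\<dots> = (\<Sum>j<n. piece_form t (L e / n) (u e j) (u e (Suc j)) (w e j) (w e (Suc j)))"
    using e by simp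
  also have "\<dots> = (\<Sum>j<n. (if j = Suc i then (?c * u e (Suc i) - u e (Suc (Suc i))) / ?S else 0)
         + (if j = i then (?c * u e (Suc i) - u e i) / ?S else 0))"
    by (intro sum.cong refl) (auto simp: piece_form_def w_def)
  also have "\<dots> = (?c * u e (Suc i) - u e (Suc (Suc i))) / ?S + (?c * u e (Suc i) - u e i) / ?S"
    using i by (simp add: sum.distrib)
  finally have "(?c * u e (Suc i) - u e (Suc (Suc i))) + (?c * u e (Suc i) - u e i) = 0"
    using S by (simp add: add_divide_distrib[symmetric])
  then show ?thesis by (simp add: algebra_simps)
qed

text \<open>
  The values of the extension and those of \<open>u\<close> obey the same three-term recurrence and agree at the first
  two nodes.
\<close>

lemma trig_extension_node:
  assumes t: "0 \<le> t" and n: "1 \<le> n"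
    and u: "\<And>w. w \<in> nodal_space n \<Longrightarrow> nodal_form n t u w = 0"
    and e: "e \<in> arcs G" and S: "sl_sin t (L e / n) \<noteq> 0" and i: "i \<le> n"
  shows "trig_extension n t u e (i * (L e / n)) = u e i"
proof -
  let ?h = "L e / n"
  let ?f = "\<lambda>x. u e 0 * sl_cos t x + (u e 1 - complex_of_real (sl_cos t ?h) * u e 0) / complex_of_real (sl_sin t ?h) * sl_sin t x"
  have "i \<le> n \<Longrightarrow> ?f (i * ?h) = u e i"
  proof (induction i rule: induct_nat_012)
    case 0
    then show ?case by simp
  next
    case 1
    then show ?case using S by simp
  next
    case (ge2 i)
    have "real (Suc (Suc i)) = real (Suc i) + 1" by simp
    then have "Suc (Suc i) * ?h = Suc i * ?h + ?h" by (simp only: distrib_right mult_1)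
    then have "?f (Suc (Suc i) * ?h) = ?f (Suc i * ?h + ?h)" by (simp only:)
    also have "\<dots> = 2 * complex_of_real (sl_cos t ?h) * ?f (Suc i * ?h) - ?f (Suc i * ?h - ?h)"
      by (rule sl_three_term[OF t])
    also have "Suc i * ?h - ?h = i * ?h" by (simp only: of_nat_Suc distrib_right mult_1)
    finally show ?case
      using ge2 radical_three_term[OF u e S, of i] by simp
  qed
  moreover have "0 \<le> i * ?h" "i * ?h \<le> L e"
  proof -
    have "i * ?h \<le> n * ?h" using i length_pos[OF e] by (intro mult_right_mono) auto
    then show "i * ?h \<le> L e" using n by simp
    show "0 \<le> i * ?h" using length_pos[OF e] by simp
  qed
  ultimately show ?thesis using e i by (simp add: trig_extension_def)
qed

text \<open>
  Inner nodes are smooth by construction. Testing with the function that is 1 at all edge ends at a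
  vertex \<open>v\<close> and 0 at all other nodes turns into the Kirchhoff condition at \<open>v\<close>.
\<close>

lemma trig_extension_eigenfunction:
  assumes t: "0 \<le> t" and n: "1 \<le> n" and uV: "u \<in> nodal_space n"
    and u: "\<And>w. w \<in> nodal_space n \<Longrightarrow> nodal_form n t u w = 0"
    and S: "\<And>e. e \<in> arcs G \<Longrightarrow> sl_sin t (L e / n) \<noteq> 0"
  shows "trig_extension n t u \<in> eigenspace G L t"
proof -
  let ?h = "\<lambda>e. L e / n"
  let ?f = "trig_extension n t u"
  define b where "b e = (u e 1 - complex_of_real (sl_cos t (?h e)) * u e 0) / complex_of_real (sl_sin t (?h e))" for e
  define g where "g e x = b e * sl_cos t x - u e 0 * (t * sl_sin t x)" for e x
  have fe: "?f e x = u e 0 * sl_cos t x + b e * sl_sin t x" if "e \<in> arcs G" "x \<in> {0..L e}" for e x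
    using that by (simp add: trig_extension_def b_def)
  have sol: "solves_ode t (L e) (?f e) (g e)" if e: "e \<in> arcs G" for e
  proof -
    have *: "solves_ode t (L e) (\<lambda>x. u e 0 * sl_cos t x + b e * sl_sin t x) (g e)"
      unfolding g_def by (rule solves_ode_sl[OF t])
    show ?thesis unfolding solves_ode_def
    proof (intro ballI conjI)
      fix x assume x: "x \<in> {0..L e}"
      show "(?f e has_vector_derivative g e x) (at x within {0..L e})"
        by (rule has_vector_derivative_transform[OF x fe[OF e]])
          (use * x in \<open>auto simp: solves_ode_def\<close>)
      show "(g e has_vector_derivative - (t * ?f e x)) (at x within {0..L e})"
        using * x fe[OF e x] by (auto simp: solves_ode_def)
    qed
  qed
  have ends: "?f e 0 = u e 0" "?f e (L e) = u e n" if e: "e \<in> arcs G" for e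
    using trig_extension_node[OF t n u e S[OF e], of 0] trig_extension_node[OF t n u e S[OF e], of n] n
    by auto
  \<comment> \<open>the derivative at the far end, read off from the value at the last but one node\<close>
  have g_end: "g e (L e) = (complex_of_real (sl_cos t (?h e)) * u e n - u e (n - 1)) / complex_of_real (sl_sin t (?h e))" if e: "e \<in> arcs G" for e
  proof -
    have "(n - 1) * ?h e = L e - ?h e" using n by (simp add: of_nat_diff field_simps)
    moreover have "?h e \<le> L e" using n length_pos[OF e] by (simp add: field_simps)
    ultimately have "u e (n - 1) = u e 0 * sl_cos t (L e - ?h e) + b e * sl_sin t (L e - ?h e)"
      using trig_extension_node[OF t n u e S[OF e], of "n - 1"] fe[OF e, of "L e - ?h e"] length_pos[OF e] n
      by simp
    also have "\<dots> = complex_of_real (sl_cos t (?h e)) * ?f e (L e) - complex_of_real (sl_sin t (?h e)) * g e (L e)"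
      using length_pos[OF e] unfolding g_def
      by (simp add: fe[OF e] sl_cos_diff[OF t] sl_sin_diff algebra_simps)
    finally show ?thesis using ends(2)[OF e] S[OF e] by (simp add: field_simps)
  qed
  have kirchhoff: "(\<Sum>e\<in>{e \<in> arcs G. head G e = v}. g e (L e)) = (\<Sum>e\<in>{e \<in> arcs G. tail G e = v}. g e 0)"
    if v: "v \<in> verts G" for v
  proof -
    define w :: "'e \<Rightarrow> nat \<Rightarrow> complex" where
      "w = (\<lambda>e i. of_bool (e \<in> arcs G \<and> (i = 0 \<and> tail G e = v \<or> i = n \<and> head G e = v)))"
    have "w \<in> nodal_space n"
      using n by (auto simp: nodal_space_def w_def intro: exI[of _ "of_bool (_ = v)"])
    then have "0 = nodal_form n t u w" using u by simp
    also have "\<dots> = (\<Sum>e\<in>arcs G.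
       (of_bool (tail G e = v) * (complex_of_real (sl_cos t (L e / n)) * u e 0 - u e 1) +
        of_bool (head G e = v) * (complex_of_real (sl_cos t (L e / n)) * u e n - u e (n - 1))) / complex_of_real (sl_sin t (L e / n)))"
      by (rule nodal_form_delta[OF n]) (simp add: w_def)
    also have "\<dots> = (\<Sum>e\<in>arcs G. (if head G e = v then g e (L e) else 0) - (if tail G e = v then g e 0 else 0))"
    proof (intro sum.cong refl)
      fix e assume e: "e \<in> arcs G"
      have "g e 0 = (u e 1 - complex_of_real (sl_cos t (L e / n)) * u e 0) / complex_of_real (sl_sin t (L e / n))"
        by (simp add: g_def b_def)
      then show "(of_bool (tail G e = v) * (complex_of_real (sl_cos t (L e / n)) * u e 0 - u e 1) +
        of_bool (head G e = v) * (complex_of_real (sl_cos t (L e / n)) * u e n - u e (n - 1))) / complex_of_real (sl_sin t (L e / n))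
        = (if head G e = v then g e (L e) else 0) - (if tail G e = v then g e 0 else 0)"
        unfolding g_end[OF e] by (simp add: diff_divide_distrib add_divide_distrib)
    qed
    also have "\<dots> = (\<Sum>e\<in>{e \<in> arcs G. head G e = v}. g e (L e)) - (\<Sum>e\<in>{e \<in> arcs G. tail G e = v}. g e 0)"
      by (simp add: sum_subtractf sum.If_cases Int_def)
    finally show ?thesis by simp
  qed
  have "continuous_at_vertices G L ?f"
    using uV unfolding continuous_at_vertices_def nodal_space_def mem_Collect_eq by (metis ends)
  moreover have "?f \<in> graph_funs G L" by (auto simp: graph_funs_def trig_extension_def)
  ultimately show ?thesis using sol kirchhoff unfolding eigenspace_iff by blast
qed

text \<open>
  Extension is linear, and it is injective on the radical since the node values can be read off again.
\<close>

lemma nullity_le_multiplicity: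
  assumes t: "0 \<le> t" and n: "1 \<le> n" and S: "\<And>e. e \<in> arcs G \<Longrightarrow> sl_sin t (L e / n) \<noteq> 0"
  shows "nodal.dim (hermitian_form.radical (nodal_form n t) (nodal_space n)) \<le> multiplicity G L t"
proof -
  interpret H: hermitian_form nf_scale "nodal_form n t" by (rule nodal_form_hermitian)
  let ?R = "H.radical (nodal_space n)"
  interpret E: Vector_Spaces.linear nf_scale gf_scale "trig_extension n t"
  proof
    show "trig_extension n t (u + w) = trig_extension n t u + trig_extension n t w" for u w
      by (auto simp: trig_extension_def fun_eq_iff algebra_simps add_divide_distrib diff_divide_distrib)
    show "trig_extension n t (nf_scale c u) = gf_scale c (trig_extension n t u)" for c u
      by (auto simp: trig_extension_def nf_scale_def gf_scale_def fun_eq_iff algebra_simps diff_divide_distrib)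
  qed
  obtain K where K: "K \<subseteq> ?R" "nodal.independent K" "?R \<subseteq> nodal.span K" "card K = nodal.dim ?R"
    using nodal.basis_exists by blast
  have "nodal.subspace ?R"
    using nodal_space_subspace[of n]
    by (auto simp: H.radical_def nodal.subspace_def H.zero_left H.add_left H.scale_left)
  then have spanK: "nodal.span K \<subseteq> ?R" using K(1) by (rule nodal.span_minimal[rotated])
  have "inj_on (trig_extension n t) (nodal.span K)"
    unfolding E.inj_on_iff_eq_0[OF nodal.subspace_span]
  proof (intro ballI impI)
    fix u assume "u \<in> nodal.span K" and 0: "trig_extension n t u = 0"
    then have u: "u \<in> nodal_space n" "\<And>w. w \<in> nodal_space n \<Longrightarrow> nodal_form n t u w = 0"
      using spanK by (auto simp: H.radical_def)
    have "u e i = 0" for e i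
    proof (cases "e \<in> arcs G \<and> i \<le> n")
      case True
      then show ?thesis using trig_extension_node[OF t n u(2), of e i] S 0 by simp
    next
      case False
      then show ?thesis using u(1) by (auto simp: nodal_space_def)
    qed
    then show "u = 0" by (auto simp: fun_eq_iff)
  qed
  then have ind: "graph_fun.independent (trig_extension n t ` K)" and inj: "inj_on (trig_extension n t) K"
    using E.independent_injective_image[OF K(2)] nodal.span_superset by (blast, blast intro: inj_on_subset)
  have sub: "trig_extension n t ` K \<subseteq> eigenspace G L t"
    using K(1) trig_extension_eigenfunction[OF t n _ _ S] by (auto simp: H.radical_def)
  obtain T where "finite T" "eigenspace G L t \<subseteq> graph_fun.span T"
    using eigenspace_finite_span[OF t] by blast
  then have "card (trig_extension n t ` K) \<le> graph_fun.dim (eigenspace G L t)"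
    using vector_space.independent_card_le_dim_of_finite_span[OF graph_fun.vector_space_axioms ind sub] by blast
  then show ?thesis using K(4) card_image[OF inj] by (simp add: multiplicity_def)
qed

text \<open>
  The half of the min-max principle that bounds eigenvalues from above. The mesh condition keeps every piece
  below half a wavelength for all parameters up to \<open>\<mu>\<close>, so that \<open>sl_sin\<close>, which occurs as a denominator, stays positive.
\<close>

theorem eigval_le_of_nonpositive_nodal:
  assumes "0 \<le> \<mu>" and n: "1 \<le> n"
    and mesh: "\<And>e. e \<in> arcs G \<Longrightarrow> sqrt \<mu> * (L e / n) < pi"
    and Q: "nodal.independent Q" "Q \<subseteq> nodal_space n"
      "\<And>u. u \<in> nodal.span Q \<Longrightarrow> Re (nodal_form n \<mu> u u) \<le> 0"
    and k: "1 \<le> k" "k \<le> card Q"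
  shows "eigval G L k \<le> \<mu>"
proof -
  have S: "0 < sl_sin t (L e / n)" if "t \<in> {0..\<mu>}" "e \<in> arcs G" for t e
  proof (rule sl_sin_pos)
    have "sqrt t * (L e / n) \<le> sqrt \<mu> * (L e / n)"
      using that length_pos[OF that(2)] by (intro mult_right_mono) auto
    then show "sqrt t * (L e / n) < pi" using mesh[OF that(2)] by simp
  qed (use that n length_pos[OF that(2)] in auto)
  obtain T where T: "finite T" "nodal_space n \<subseteq> nodal.span T"
    using nodal_space_finite_span by blast
  obtain M where M: "finite M" "M \<subseteq> {0..\<mu>}"
    "card Q \<le> (\<Sum>\<nu>\<in>M. nodal.dim (hermitian_form.radical (nodal_form n \<nu>) (nodal_space n)))"
    using spectral_flow[OF nodal.vector_space_axioms nodal_form_hermitian \<open>0 \<le> \<mu>\<close>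
        nodal_space_subspace T(2,1) nodal_form_continuous nodal_form_nonneg_at_0 Q] S by blast
  have "nodal.dim (hermitian_form.radical (nodal_form n \<nu>) (nodal_space n)) \<le> multiplicity G L \<nu>"
    if "\<nu> \<in> M" for \<nu>
  proof (rule nullity_le_multiplicity[OF _ n])
    have "\<nu> \<in> {0..\<mu>}" using that M(2) by blast
    then show "0 \<le> \<nu>" "\<And>e. e \<in> arcs G \<Longrightarrow> sl_sin \<nu> (L e / n) \<noteq> 0"
      using S by (auto simp: less_le)
  qed
  then have "(\<Sum>\<nu>\<in>M. nodal.dim (hermitian_form.radical (nodal_form n \<nu>) (nodal_space n)))
      \<le> (\<Sum>\<nu>\<in>M. multiplicity G L \<nu>)" by (intro sum_mono)
  then have "k \<le> (\<Sum>\<nu>\<in>M. multiplicity G L \<nu>)" using M(3) k(2) by linarith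
  then show ?thesis using M(1,2) k(1) by (intro eigval_le[of M]) auto
qed

end

section \<open>Test functions along a trail\<close>

text \<open>
  The index of the interval between consecutive zeros of the cosine; interval \<open>m\<close> is centred at \<open>m \<pi>\<close>.
\<close>

definition nodal_domain :: "real \<Rightarrow> int" where
  "nodal_domain \<theta> = \<lfloor>\<theta> / pi + 1 / 2\<rfloor>"

text \<open>
  Two points in different nodal domains at distance less than \<open>\<pi>\<close> have exactly one zero \<open>z\<close> between them, the
  left end of the domain of the larger one; expanding both cosines around \<open>z\<close> shows the signs.
\<close>

lemma cos_sign_change:
  assumes "\<bar>\<theta>\<^sub>1 - \<theta>\<^sub>2\<bar> < pi" "nodal_domain \<theta>\<^sub>1 \<noteq> nodal_domain \<theta>\<^sub>2"
  shows "cos \<theta>\<^sub>1 * cos \<theta>\<^sub>2 \<le> 0"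
proof -
  have *: "cos a * cos b \<le> 0" if ab: "\<bar>a - b\<bar> < pi" "nodal_domain a < nodal_domain b" for a b
  proof -
    define m where "m = nodal_domain b"
    define z where "z = of_int m * pi - pi / 2"
    have "a / pi + 1 / 2 < of_int m" using ab(2) unfolding m_def nodal_domain_def by linarith
    then have az: "a < z" unfolding z_def by (simp add: field_simps)
    have "of_int m \<le> b / pi + 1 / 2" unfolding m_def nodal_domain_def by linarith
    then have zb: "z \<le> b" unfolding z_def by (simp add: field_simps)
    have "cos z = 0" unfolding z_def using sin_npi_int[of m] by (simp add: cos_diff mult.commute)
    then have "cos a = sin z * sin (z - a)" "cos b = - (sin z * sin (b - z))"
      using cos_diff[of z "z - a"] cos_add[of z "b - z"] by simp_all
    then have "cos a * cos b = - ((sin z)\<^sup>2 * (sin (z - a) * sin (b - z)))"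
      by (simp add: power2_eq_square algebra_simps)
    moreover have "0 \<le> sin (z - a)" "0 \<le> sin (b - z)"
      using az zb ab(1) by (auto intro!: sin_ge_zero)
    ultimately show ?thesis by simp
  qed
  show ?thesis
  proof (cases "nodal_domain \<theta>\<^sub>1 < nodal_domain \<theta>\<^sub>2")
    case True
    then show ?thesis using *[OF assms(1)] by simp
  next
    case False
    then show ?thesis using *[of \<theta>\<^sub>2 \<theta>\<^sub>1] assms by (simp add: abs_minus_commute mult.commute)
  qed
qed

lemma near_extremum:
  assumes "\<bar>\<theta> - real m * pi\<bar> < pi / 2"
  shows "nodal_domain \<theta> = int m" "cos \<theta> \<noteq> 0"
proof -
  have "\<theta> / pi - real m = (\<theta> - real m * pi) / pi" by (simp add: field_simps)
  then have "\<bar>\<theta> / pi - real m\<bar> < 1 / 2"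
    using assms by (simp add: abs_divide field_simps)
  then have "real m \<le> \<theta> / pi + 1 / 2" "\<theta> / pi + 1 / 2 < real m + 1" by linarith+
  then show "nodal_domain \<theta> = int m"
    unfolding nodal_domain_def by (intro floor_unique) simp_all
  have "cos \<theta> = cos (real m * pi + (\<theta> - real m * pi))" by simp
  also have "\<dots> = (-1) ^ m * cos (\<theta> - real m * pi)"
    by (subst cos_add) (simp add: cos_npi sin_npi mult.commute)
  finally have "cos \<theta> = (-1) ^ m * cos (\<theta> - real m * pi)" .
  moreover have "0 < cos (\<theta> - real m * pi)"
    using assms by (intro cos_gt_zero_pi) linarith+
  ultimately show "cos \<theta> \<noteq> 0" by simp
qed

text \<open>
  The boundary term \<open>|c|\<^sup>2 \<phi> \<phi>'\<close> for \<open>\<phi> = cos (s x)\<close> with amplitude \<open>c\<close> constant on nodal domains. It is the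
  primitive of the energy density, apart from what is lost where the amplitude jumps.
\<close>

definition flux :: "(int \<Rightarrow> complex) \<Rightarrow> real \<Rightarrow> real \<Rightarrow> real" where
  "flux c s x = - s * (cmod (c (nodal_domain (s * x))))\<^sup>2 * cos (s * x) * sin (s * x)"

definition domain_cos :: "(int \<Rightarrow> complex) \<Rightarrow> real \<Rightarrow> real \<Rightarrow> complex" where
  "domain_cos c s x = c (nodal_domain (s * x)) * complex_of_real (cos (s * x))"

lemma piece_form_flip: "piece_form t h a b a b = piece_form t h b a b a"
  by (simp add: piece_form_def add.commute)

text \<open>
  A discrete Jacobi identity: with amplitudes \<open>\<alpha>\<close>, \<open>\<beta>\<close> at the ends the energy of the piece is the increment of the
  flux plus a positive multiple of \<open>cos X cos (X + H) |\<alpha> - \<beta>|\<^sup>2\<close>. If the amplitudes differ, then the cosine changes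
  sign between the ends and this term is not positive. In this form the zeros of the cosine need not be nodes.
\<close>

lemma piece_form_domain_cos_le:
  assumes s: "0 < s" and h: "0 < h" "s * h < pi"
  shows "Re (piece_form (s\<^sup>2) h (domain_cos c s x) (domain_cos c s (x + h))
      (domain_cos c s x) (domain_cos c s (x + h))) \<le> flux c s (x + h) - flux c s x"
proof -
  define X where "X = s * x"
  define H where "H = s * h"
  have sxh: "s * (x + h) = X + H" by (simp add: X_def H_def distrib_left)
  define \<alpha> where "\<alpha> = c (nodal_domain X)"
  define \<beta> where "\<beta> = c (nodal_domain (X + H))"
  have H: "0 < H" "H < pi" using s h by (auto simp: H_def)
  have sinH: "0 < sin H" using H by (intro sin_gt_zero)
  have neg: "cos X * cos (X + H) * (cmod (\<alpha> - \<beta>))\<^sup>2 \<le> 0"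
  proof (cases "nodal_domain X = nodal_domain (X + H)")
    case False
    then have "cos X * cos (X + H) \<le> 0" using H by (intro cos_sign_change) auto
    then show ?thesis by (rule mult_nonpos_nonneg) simp
  qed (simp add: \<alpha>_def \<beta>_def)
  have t: "sl_cos (s\<^sup>2) h = cos H" "sl_sin (s\<^sup>2) h = sin H / s"
    using s by (auto simp: sl_cos_def sl_sin_def H_def)
  have 1: "cos H * cos X - cos (X + H) = sin X * sin H" by (simp add: cos_add)
  have "cos X = cos ((X + H) - H)" by simp
  then have 2: "cos H * cos (X + H) - cos X = - (sin (X + H) * sin H)"
    by (simp only: cos_diff) (simp add: mult.commute)
  let ?a = "domain_cos c s x" and ?b = "domain_cos c s (x + h)"
  have ab: "?a = \<alpha> * complex_of_real (cos X)" "?b = \<beta> * complex_of_real (cos (X + H))"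
    by (simp_all add: domain_cos_def \<alpha>_def \<beta>_def sxh X_def[symmetric])
  have "Re (piece_form (s\<^sup>2) h ?a ?b ?a ?b)
      = (cos H * ((cmod ?a)\<^sup>2 + (cmod ?b)\<^sup>2) - 2 * (Re ?a * Re ?b + Im ?a * Im ?b)) / (sin H / s)"
    unfolding piece_form_def t cmod_power2 by (simp add: power2_eq_square algebra_simps)
  also have "cos H * ((cmod ?a)\<^sup>2 + (cmod ?b)\<^sup>2) - 2 * (Re ?a * Re ?b + Im ?a * Im ?b)
      = (cmod \<alpha>)\<^sup>2 * cos X * (cos H * cos X - cos (X + H))
       + (cmod \<beta>)\<^sup>2 * cos (X + H) * (cos H * cos (X + H) - cos X)
       + cos X * cos (X + H) * (cmod (\<alpha> - \<beta>))\<^sup>2"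
    unfolding ab cmod_power2 by (simp add: power2_eq_square algebra_simps)
  also have "\<dots> \<le> sin H * ((cmod \<alpha>)\<^sup>2 * cos X * sin X - (cmod \<beta>)\<^sup>2 * cos (X + H) * sin (X + H))"
    using neg unfolding 1 2 by (simp add: algebra_simps)
  finally have "Re (piece_form (s\<^sup>2) h ?a ?b ?a ?b)
      \<le> sin H * ((cmod \<alpha>)\<^sup>2 * cos X * sin X - (cmod \<beta>)\<^sup>2 * cos (X + H) * sin (X + H)) / (sin H / s)"
    using s sinH by (simp add: divide_right_mono)
  also have "\<dots> = flux c s (x + h) - flux c s x"
  proof -
    have "flux c s x = - s * (cmod \<alpha>)\<^sup>2 * cos X * sin X"
      by (simp only: flux_def \<alpha>_def X_def)
    moreover have "flux c s (x + h) = - s * (cmod \<beta>)\<^sup>2 * cos (X + H) * sin (X + H)"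
      by (simp only: flux_def \<beta>_def sxh)
    ultimately show ?thesis using s sinH by (simp add: field_simps)
  qed
  finally show ?thesis .
qed

text \<open>
  The three kinds of edges: traversed forwards, traversed backwards, or off the trail, where the values are
  constant and the energy is not positive.
\<close>

lemma piece_form_domain_cos_oriented:
  assumes s: "0 < s" and h: "0 < h" "s * h < pi" and \<epsilon>: "\<epsilon> \<in> {-1, 0, 1}"
  shows "Re (piece_form (s\<^sup>2) h (domain_cos c s x) (domain_cos c s (x + \<epsilon> * h))
      (domain_cos c s x) (domain_cos c s (x + \<epsilon> * h))) \<le> \<epsilon> * (flux c s (x + \<epsilon> * h) - flux c s x)"
proof -
  consider "\<epsilon> = 1" | "\<epsilon> = -1" | "\<epsilon> = 0" using \<epsilon> by auto
  then show ?thesis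
  proof cases
    case 1
    then show ?thesis using piece_form_domain_cos_le[OF s h, of c x] by simp
  next
    case 2
    then show ?thesis
      using piece_form_domain_cos_le[OF s h, of c "x - h"]
        piece_form_flip[of _ _ "domain_cos c s x" "domain_cos c s (x - h)"] by simp
  next
    case 3
    let ?a = "domain_cos c s x"
    have "0 < sl_sin (s\<^sup>2) h" using s h by (intro sl_sin_pos) auto
    moreover have "sl_cos (s\<^sup>2) h \<le> 1" by (simp add: sl_cos_def)
    moreover have "Re (piece_form (s\<^sup>2) h ?a ?a ?a ?a)
        = 2 * ((sl_cos (s\<^sup>2) h - 1) * (cmod ?a)\<^sup>2) / sl_sin (s\<^sup>2) h"
      unfolding piece_form_def cmod_power2 by (simp add: power2_eq_square algebra_simps)
    ultimately show ?thesis using 3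
      by (simp add: divide_nonpos_pos mult_nonpos_nonneg)
  qed
qed

context metric_graph
begin

definition orientation :: "('e \<times> bool) list \<Rightarrow> 'e \<Rightarrow> real" where
  "orientation p e = (if (e, True) \<in> set p then 1 else if (e, False) \<in> set p then -1 else 0)"

lemma sum_orientation:
  assumes p: "bi.awalk u p v" "distinct (map fst p)"
  shows "(\<Sum>e\<in>arcs G. orientation p e * (F (head G e) - F (tail G e))) = F v - F u"
proof -
  have inj: "inj_on fst (set p)" and dist: "distinct p"
    using p(2) by (auto simp: distinct_map)
  have sub: "fst ` set p \<subseteq> arcs G" using p(1) by (auto simp: bi.awalk_def)
  have "F v - F u = (\<Sum>a\<leftarrow>p. F (head (bidirected G) a) - F (tail (bidirected G) a))"
    using telescope_walk[OF p(1)] by simp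
  also have "\<dots> = (\<Sum>a\<in>set p. F (head (bidirected G) a) - F (tail (bidirected G) a))"
    by (rule sum_list_distinct_conv_sum_set[OF dist])
  also have "\<dots> = (\<Sum>a\<in>set p. orientation p (fst a) * (F (head G (fst a)) - F (tail G (fst a))))"
  proof (intro sum.cong refl)
    fix a assume a: "a \<in> set p"
    have "(fst a, True) \<notin> set p" if "\<not> snd a"
      using inj_onD[OF inj, of a "(fst a, True)"] a that by (metis fst_conv snd_conv)
    moreover have "(fst a, snd a) \<in> set p" using a by simp
    ultimately show "F (head (bidirected G) a) - F (tail (bidirected G) a)
        = orientation p (fst a) * (F (head G (fst a)) - F (tail G (fst a)))"
      by (cases "snd a") (simp_all add: orientation_def)
  qed
  also have "\<dots> = (\<Sum>e\<in>fst ` set p. orientation p e * (F (head G e) - F (tail G e)))"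
    by (simp add: sum.reindex[OF inj])
  also have "\<dots> = (\<Sum>e\<in>arcs G. orientation p e * (F (head G e) - F (tail G e)))"
  proof (rule sum.mono_neutral_left[OF _ sub])
    have "orientation p e = 0" if "e \<notin> fst ` set p" for e
      using that by (force simp: orientation_def)
    then show "\<forall>e\<in>arcs G - fst ` set p. orientation p e * (F (head G e) - F (tail G e)) = 0" by simp
  qed simp
  finally show ?thesis by simp
qed

end

context metric_tree
begin

text \<open>
  The coordinate \<open>\<psi>\<close>, extended linearly to the nodes as \<open>pos\<close>, carries the functions \<open>cos (s x)\<close> with
  \<open>s = k \<pi> / \<Lambda>\<close> and amplitudes on the nodal domains to node values. The flux vanishes at \<open>0\<close> and at \<open>\<Lambda>\<close>, the
  positions of the two ends of the trail, so these node values have nonpositive energy. The mesh is so fine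
  that each of the \<open>k + 1\<close> nodal domains that meet \<open>[0, \<Lambda>]\<close> contains a node where the cosine is not 0; evaluation
  there shows that the \<open>k + 1\<close> restrictions are linearly independent.
\<close>

theorem eigval_le_of_trail:
  assumes p: "p \<noteq> []" "bi.awalk u p v" "distinct (map fst p)" and k: "1 \<le> k"
  shows "eigval G L (k + 1) \<le> (real k * pi / (\<Sum>a\<leftarrow>p. L (fst a)))\<^sup>2"
proof -
  define \<Lambda> where "\<Lambda> = (\<Sum>a\<leftarrow>p. L (fst a))"
  define s where "s = real k * pi / \<Lambda>"
  define \<epsilon> where "\<epsilon> = orientation p"
  have \<epsilon>: "\<epsilon> e \<in> {-1, 0, 1}" for e by (auto simp: \<epsilon>_def orientation_def)
  obtain \<psi>0 where \<psi>0: "\<forall>e\<in>arcs G. \<psi>0 (head G e) - \<psi>0 (tail G e) = \<epsilon> e * L e"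
    using potential_exists[of "\<lambda>e. \<epsilon> e * L e"] by blast
  define \<psi> where "\<psi> w = \<psi>0 w - \<psi>0 u" for w
  have \<psi>: "\<psi> (head G e) = \<psi> (tail G e) + \<epsilon> e * L e" if "e \<in> arcs G" for e
    using \<psi>0 that by (auto simp: \<psi>_def algebra_simps)
  have \<psi>u: "\<psi> u = 0" by (simp add: \<psi>_def)
  have pG: "fst a \<in> arcs G" if "a \<in> set p" for a using p(2) that by (auto simp: bi.awalk_def)
  have inj: "inj_on fst (set p)" using p(3) by (auto simp: distinct_map)
  have step: "\<psi> (head (bidirected G) a) - \<psi> (tail (bidirected G) a) = L (fst a)" if a: "a \<in> set p" for a
  proof -
    have "(fst a, True) \<notin> set p" if "\<not> snd a"
      using inj_onD[OF inj, of a "(fst a, True)"] a that by (metis fst_conv snd_conv)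
    moreover have "(fst a, snd a) \<in> set p" using a by simp
    ultimately show ?thesis
      using \<psi>[OF pG[OF a]] by (cases "snd a") (simp_all add: \<epsilon>_def orientation_def)
  qed
  have "\<Lambda> = (\<Sum>a\<leftarrow>p. \<psi> (head (bidirected G) a) - \<psi> (tail (bidirected G) a))"
    unfolding \<Lambda>_def by (intro arg_cong[where f=sum_list] map_cong refl) (simp only: step)
  then have \<psi>v: "\<psi> v = \<Lambda>" using telescope_walk[OF p(2), of \<psi>] \<psi>u by simp
  have \<Lambda>: "0 < \<Lambda>"
  proof -
    obtain a q where pq: "p = a # q" using p(1) by (cases p) auto
    have "0 \<le> L (fst b)" if "b \<in> set p" for b using length_pos[OF pG[OF that]] by simp
    then have "0 \<le> (\<Sum>a\<leftarrow>q. L (fst a))" by (intro sum_list_nonneg) (auto simp: pq)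
    moreover have "0 < L (fst a)" using length_pos[OF pG] pq by simp
    ultimately show ?thesis by (simp add: \<Lambda>_def pq)
  qed
  have s: "0 < s" using k \<Lambda> by (simp add: s_def)
  have s\<Lambda>: "s * \<Lambda> = real k * pi" using \<Lambda> by (simp add: s_def)
  \<comment> \<open>pieces shorter than a quarter of a wavelength: half the length of a nodal domain\<close>
  obtain n :: nat where n: "1 \<le> n" and mesh: "\<And>e. e \<in> arcs G \<Longrightarrow> s * (L e / n) < pi / 2"
  proof -
    obtain n0 :: nat where n0: "Max (L ` arcs G) * s / (pi / 2) < n0" using reals_Archimedean2 by blast
    have "s * (L e / (Suc n0)) < pi / 2" if "e \<in> arcs G" for e
    proof -
      have "L e \<le> Max (L ` arcs G)" using that by simp
      then have "L e * s \<le> Max (L ` arcs G) * s" using s by (simp add: mult_right_mono)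
      also have "\<dots> < n0 * (pi / 2)" using n0 by (simp add: field_simps)
      also have "\<dots> < Suc n0 * (pi / 2)" by simp
      finally show ?thesis by (simp add: field_simps)
    qed
    then show ?thesis by (intro that[of "Suc n0"]) auto
  qed
  define h where "h e = L e / n" for e
  have h: "0 < h e" "s * h e < pi / 2" "n * h e = L e" if "e \<in> arcs G" for e
    using n length_pos[OF that] mesh[OF that] by (auto simp: h_def)
  define pos where "pos e i = \<psi> (tail G e) + \<epsilon> e * (real i * h e)" for e i
  have pos_ends: "pos e 0 = \<psi> (tail G e)" "pos e n = \<psi> (head G e)" if "e \<in> arcs G" for e
    using \<psi>[OF that] h(3)[OF that] by (auto simp: pos_def)
  have pos_Suc: "pos e (Suc i) = pos e i + \<epsilon> e * h e" for e i
    by (simp add: pos_def algebra_simps)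
  define sample where "sample c = (\<lambda>e i. if e \<in> arcs G \<and> i \<le> n then domain_cos c s (pos e i) else 0)" for c
  have sample_V: "sample c \<in> nodal_space n" for c
    unfolding nodal_space_def sample_def
    using pos_ends by (auto intro!: exI[of _ "domain_cos c s (\<psi> _)"])
  have nonpos: "Re (nodal_form n (s\<^sup>2) (sample c) (sample c)) \<le> 0" for c
  proof -
    let ?f = "\<lambda>e i. domain_cos c s (pos e i)" and ?F = "\<lambda>w. flux c s (\<psi> w)"
    have "Re (nodal_form n (s\<^sup>2) (sample c) (sample c))
        = (\<Sum>e\<in>arcs G. \<Sum>i<n. Re (piece_form (s\<^sup>2) (h e) (?f e i) (?f e (Suc i)) (?f e i) (?f e (Suc i))))"
      unfolding nodal_form_def Re_sum by (intro sum.cong refl) (simp add: sample_def h_def)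
    also have "\<dots> \<le> (\<Sum>e\<in>arcs G. \<Sum>i<n. \<epsilon> e * (flux c s (pos e (Suc i)) - flux c s (pos e i)))"
    proof (intro sum_mono)
      fix e i assume e: "e \<in> arcs G"
      have "s * h e < pi" using h(2)[OF e] pi_gt_zero by linarith
      then show "Re (piece_form (s\<^sup>2) (h e) (?f e i) (?f e (Suc i)) (?f e i) (?f e (Suc i)))
          \<le> \<epsilon> e * (flux c s (pos e (Suc i)) - flux c s (pos e i))"
        unfolding pos_Suc by (intro piece_form_domain_cos_oriented s h(1)[OF e] \<epsilon>)
    qed
    also have "\<dots> = (\<Sum>e\<in>arcs G. \<epsilon> e * (?F (head G e) - ?F (tail G e)))"
    proof (intro sum.cong refl)
      fix e assume e: "e \<in> arcs G"
      show "(\<Sum>i<n. \<epsilon> e * (flux c s (pos e (Suc i)) - flux c s (pos e i))) = \<epsilon> e * (?F (head G e) - ?F (tail G e))"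
        using sum_lessThan_telescope[of "\<lambda>i. flux c s (pos e i)" n] pos_ends[OF e]
        by (simp add: sum_distrib_left[symmetric])
    qed
    also have "\<dots> = ?F v - ?F u" unfolding \<epsilon>_def by (rule sum_orientation[OF p(2,3)])
    also have "\<dots> = 0" unfolding \<psi>u \<psi>v by (simp add: flux_def s\<Lambda> sin_npi)
    finally show ?thesis .
  qed
  \<comment> \<open>nodes are dense along the trail, at the scale of half a nodal domain\<close>
  have dense: "\<exists>e\<in>arcs G. \<exists>i\<le>n. \<bar>s * pos e i - s * y\<bar> < pi / 2" if y: "0 \<le> y" "y \<le> \<Lambda>" for y
  proof -
    obtain a where a: "a \<in> set p" and ay: "\<psi> (tail (bidirected G) a) \<le> y" "y \<le> \<psi> (head (bidirected G) a)"
      using walk_crosses_level[OF p(2,1), of \<psi> y] y \<psi>u \<psi>v by auto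
    define e where "e = fst a"
    have e: "e \<in> arcs G" using pG[OF a] by (simp add: e_def)
    have "\<exists>x. 0 \<le> x \<and> x \<le> L e \<and> y = \<psi> (tail G e) + \<epsilon> e * x \<and> \<bar>\<epsilon> e\<bar> \<le> 1"
    proof (cases "snd a")
      case True
      then have "(e, True) \<in> set p" using a by (simp add: e_def) (metis prod.collapse)
      then have "\<epsilon> e = 1" by (simp add: \<epsilon>_def orientation_def)
      then show ?thesis using ay step[OF a] True
        by (intro exI[of _ "y - \<psi> (tail G e)"]) (auto simp: e_def)
    next
      case False
      have "(e, False) \<in> set p" using a False by (simp add: e_def) (metis prod.collapse)
      moreover have "(e, True) \<notin> set p"
        using inj_onD[OF inj, of a "(e, True)"] a False by (metis e_def fst_conv snd_conv)
      ultimately have "\<epsilon> e = -1" by (simp add: \<epsilon>_def orientation_def)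
      then show ?thesis using ay step[OF a] False
        by (intro exI[of _ "\<psi> (tail G e) - y"]) (auto simp: e_def)
    qed
    then obtain x where x: "0 \<le> x" "x \<le> L e" "y = \<psi> (tail G e) + \<epsilon> e * x" "\<bar>\<epsilon> e\<bar> \<le> 1" by blast
    define i where "i = nat \<lfloor>x / h e\<rfloor>"
    have i: "real i = of_int \<lfloor>x / h e\<rfloor>" using x(1) h(1)[OF e] by (simp add: i_def)
    have "real i \<le> x / h e" "x / h e < real i + 1" unfolding i by linarith+
    then have near: "0 \<le> x - i * h e" "x - i * h e < h e"
      using h(1)[OF e] by (auto simp: field_simps)
    have "x / h e \<le> n" using x(2) h(1,3)[OF e] by (simp add: field_simps)
    then have "real i \<le> n" using \<open>real i \<le> x / h e\<close> by linarith
    then have "i \<le> n" by simp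
    moreover have "\<bar>s * pos e i - s * y\<bar> < pi / 2"
    proof -
      have "s * pos e i - s * y = - (\<epsilon> e * (s * (x - i * h e)))"
        unfolding x(3) pos_def by (simp add: algebra_simps)
      then have "\<bar>s * pos e i - s * y\<bar> = \<bar>\<epsilon> e\<bar> * (s * (x - i * h e))"
        using s near by (simp add: abs_mult)
      also have "\<dots> \<le> 1 * (s * (x - i * h e))" using x(4) s near by (intro mult_right_mono) auto
      also have "\<dots> < s * h e" using s near by simp
      finally show ?thesis using h(2)[OF e] by simp
    qed
    ultimately show ?thesis using e by blast
  qed
  \<comment> \<open>a node close to the extremum \<open>m \<Lambda> / k\<close> of the cosine\<close>
  have "\<exists>e i. e \<in> arcs G \<and> i \<le> n \<and> nodal_domain (s * pos e i) = int m \<and> cos (s * pos e i) \<noteq> 0"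
    if "m \<le> k" for m
  proof -
    define y where "y = real m * \<Lambda> / real k"
    have y: "0 \<le> y" "y \<le> \<Lambda>" "s * y = real m * pi"
      using that k \<Lambda> by (auto simp: y_def s_def field_simps)
    show ?thesis using dense[OF y(1,2)] near_extremum unfolding y(3) by blast
  qed
  then obtain E I where EI: "\<And>m. m \<le> k \<Longrightarrow> E m \<in> arcs G \<and> I m \<le> n \<and>
      nodal_domain (s * pos (E m) (I m)) = int m \<and> cos (s * pos (E m) (I m)) \<noteq> 0"
    by metis
  define bump where "bump m = sample (\<lambda>j. of_bool (j = int m))" for m :: nat
  have bump_at: "bump m (E m') (I m') = of_bool (m = m') * complex_of_real (cos (s * pos (E m') (I m')))"
    if "m' \<le> k" for m m'
    using EI[OF that] by (auto simp: bump_def sample_def domain_cos_def)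
  have inj_bump: "inj_on bump {..k}"
  proof (rule inj_onI)
    fix m m' assume m: "m \<in> {..k}" "m' \<in> {..k}" "bump m = bump m'"
    have "bump m (E m) (I m) \<noteq> 0" using bump_at[of m m] EI[of m] m by simp
    then have "bump m' (E m) (I m) \<noteq> 0" unfolding m(3) .
    then show "m = m'" using bump_at[where m = m' and m' = m] m(1) by (cases "m = m'") simp_all
  qed
  define Q where "Q = bump ` {..k}"
  have "card Q = k + 1" using card_image[OF inj_bump] by (simp add: Q_def)
  moreover have "nodal.independent Q"
  proof (rule nodal.independent_if_scalars_zero)
    fix f x assume sum0: "(\<Sum>x\<in>Q. nf_scale (f x) x) = 0" and x: "x \<in> Q"
    obtain m where m: "m \<le> k" "x = bump m" using x by (auto simp: Q_def)
    have "0 = (\<Sum>x\<in>Q. nf_scale (f x) x) (E m) (I m)" by (simp add: sum0)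
    also have "\<dots> = (\<Sum>m'\<le>k. f (bump m') * bump m' (E m) (I m))"
      unfolding Q_def sum.reindex[OF inj_bump] sum_fun_apply by (simp add: nf_scale_def)
    also have "\<dots> = (\<Sum>m'\<le>k. if m' = m then f x * complex_of_real (cos (s * pos (E m) (I m))) else 0)"
      using bump_at[OF m(1)] m(2) by (intro sum.cong refl) auto
    also have "\<dots> = f x * complex_of_real (cos (s * pos (E m) (I m)))" using m(1) by simp
    finally show "f x = 0" using EI[OF m(1)] by simp
  qed (simp add: Q_def)
  moreover have "Q \<subseteq> nodal_space n" using sample_V by (auto simp: Q_def bump_def)
  moreover have "Re (nodal_form n (s\<^sup>2) w w) \<le> 0" if "w \<in> nodal.span Q" for w
  proof -
    \<comment> \<open>amplitudes may be arbitrary here, also on nodal domains outside \<open>[0, \<Lambda>]\<close>\<close>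
    have "nodal.subspace (range sample)"
    proof (rule nodal.subspaceI)
      have "0 = sample (\<lambda>_. 0)" by (auto simp: sample_def domain_cos_def fun_eq_iff)
      then show "0 \<in> range sample" by blast
      show "x + y \<in> range sample" if xy: "x \<in> range sample" "y \<in> range sample" for x y
      proof -
        obtain c d where "x = sample c" "y = sample d" using xy by blast
        then have "x + y = sample (\<lambda>j. c j + d j)"
          by (auto simp: sample_def domain_cos_def fun_eq_iff distrib_right)
        then show ?thesis by blast
      qed
      show "nf_scale a x \<in> range sample" if xs: "x \<in> range sample" for a x
      proof -
        obtain c where "x = sample c" using xs by blast
        then have "nf_scale a x = sample (\<lambda>j. a * c j)"
          by (auto simp: sample_def domain_cos_def fun_eq_iff nf_scale_def)
        then show ?thesis by blast
      qed
    qed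
    then have "nodal.span Q \<subseteq> range sample"
      by (intro nodal.span_minimal) (auto simp: Q_def bump_def)
    then show ?thesis using that nonpos by blast
  qed
  moreover have "sqrt (s\<^sup>2) * (L e / n) < pi" if "e \<in> arcs G" for e
  proof -
    have "s * (L e / n) < pi" using mesh[OF that] pi_gt_zero by linarith
    then show ?thesis using s by simp
  qed
  ultimately have "eigval G L (k + 1) \<le> s\<^sup>2"
    by (intro eigval_le_of_nonpositive_nodal[of "s\<^sup>2" n Q]) (use n in auto)
  then show ?thesis by (simp add: s_def \<Lambda>_def)
qed

end

theorem theorem3p4:
  fixes G :: "('v, 'e) pre_digraph" and L :: "'e \<Rightarrow> real" and k :: nat
  assumes "metric_graph G L"
    and "graph_tree G"
    and "k \<ge> 1"
  shows "eigval G L (k + 1) \<le> (real k)\<^sup>2 * pi\<^sup>2 / (mg_diam G L)\<^sup>2"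
proof -
  interpret metric_tree G L
    using assms by (simp add: metric_tree_def metric_tree_axioms_def)
  obtain u p v where p: "p \<noteq> []" "bi.awalk u p v" "distinct (map fst p)"
    and diam: "0 < mg_diam G L" "mg_diam G L \<le> (\<Sum>a\<leftarrow>p. L (fst a))"
    by (rule diameter_le_trail)
  have "eigval G L (k + 1) \<le> (real k * pi / (\<Sum>a\<leftarrow>p. L (fst a)))\<^sup>2"
    by (rule eigval_le_of_trail[OF p assms(3)])
  also have "\<dots> \<le> (real k * pi / mg_diam G L)\<^sup>2"
    using diam by (intro power_mono divide_left_mono) auto
  finally show ?thesis by (simp add: power_divide power_mult_distrib)
qed

end
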